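(* Let $\underline\lambda=(\lambda^{(1)},\dots,\lambda^{(r)})$ be an $r$-partition of $n$ with $n_i=|\lambda^{(i)}|$. The transition matrix $\mathcal{A}_{\underline\lambda}=(A_{S,T})_{S,T\in\mathrm{SYT}(\underline\lambda)}$ of the $\mathbb{G}_{r,n}$-module $\mathbb{G}_{r,n}^{\underline\lambda}$, defined by $n_T=\sum_SA_{S,T}v_S$, is of the form $$\mathcal{A}_{\underline\lambda}=\bigl(\mathcal{A}_{\lambda^{(1)}}\otimes\cdots\otimes\mathcal{A}_{\lambda^{(r)}}\bigr)^{\oplus\binom{n}{n_1,\dots,n_r}}.$$ That is, when the standard $r$-tableaux are grouped by alphabet, and the tableaux with a given alphabet are identified with $\mathrm{SYT}(\lambda^{(1)})\times\cdots\times\mathrm{SYT}(\lambda^{(r)})$ by order-preserving relabeling of the entries of each component, $\mathcal{A}_{\underline\lambda}$ is the direct sum of $\binom{n}{n_1,\dots,n_r}$ identical copies (one for each choice of alphabet) of the tensor product $\mathcal{A}_{\lambda^{(1)}}\otimes\cdots\otimes\mathcal{A}_{\lambda^{(r)}}$, where $\mathcal{A}_{\lambda^{(i)}}$ is the symmetric group $\mathbb{S}_{n_i}$ transition matrix for $\lambda^{(i)}$. In particular, the matrix blocks are independent of the choice of alphabet.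
   Context: Tableaux. An $r$-partition of $n$ is an $r$-tuple $\underline\lambda=(\lambda^{(1)},\dots,\lambda^{(r)})$ of (possibly empty) partitions with $|\lambda^{(1)}|+\cdots+|\lambda^{(r)}|=n$. An $r$-tableau of shape $\underline\lambda$ is a filling $T=(T^{(1)},\dots,T^{(r)})$ of its boxes by $1,\dots,n$, each used once; it is standard if in each component the entries increase left to right in rows and top to bottom in columns. $\mathrm{SYT}(\underline\lambda)$ is the set of standard $r$-tableaux. $\sigma\in\mathbb{S}_n$ acts by replacing each entry $k$ by $\sigma(k)$; $s_i=(i,i+1)$. The column reading tableau $C$ is obtained by entering $1,\dots,n$ consecutively down the columns, beginning with the leftmost component and filling columns (and then components) from left to right. $w_T\in\mathbb{S}_n$ is the unique permutation with $w_T(C)=T$. The alphabet of $T$ is the ordered set partition of $\{1,\dots,n\}$ whose $i$-th block is the set of entries of $T^{(i)}$. Module. $\mathbb{G}_{r,n}=\mathbb{Z}_r\wr\mathbb{S}_n$ is generated by $s_0,\dots,s_{n-1}$ with relations $s_is_j=s_js_i$ ($|i-j|>1$), $s_is_{i+1}s_i=s_{i+1}s_is_{i+1}$ ($1\le i\le n-2$), $s_0s_1s_0s_1=s_1s_0s_1s_0$, $s_i^2=1$ ($1\le i\le n-1$), $s_0^r=1$; it contains $\mathbb{S}_n=\langle s_1,\dots,s_{n-1}\rangle$. Let $\xi$ be a primitive $r$-th root of unity. The content of a box in row $x$ (counted downward) and column $y$ of its component is $y-x$; $T(i)$ is the box of $T$ containing $i$, and $a_i(T)=\dfrac{1}{ct(T(i+1))-ct(T(i))}$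 when $i,i+1$ are in the same component. $\mathbb{G}_{r,n}^{\underline\lambda}$ has $\mathbb{C}$-basis $\{v_T\mid T\in\mathrm{SYT}(\underline\lambda)\}$ (the seminormal basis) with action $s_0v_T=\xi^{k-1}v_T$ if $1$ is in the $k$-th component of $T$; and for $1\le i\le n-1$, $s_iv_T=v_{s_i(T)}$ if $i,i+1$ are in different components of $T$, and $s_iv_T=a_i(T)v_T+(1+a_i(T))v_{s_i(T)}$ if they are in the same component, with $v_{s_i(T)}=0$ if $s_i(T)$ is nonstandard. The natural basis is $\{n_T\mid T\in\mathrm{SYT}(\underline\lambda)\}$ with $n_T:=w_Tv_C$. Symmetric group transition matrices. For a partition $\lambda$ of $m$, $\mathcal{A}_\lambda=(A_{P,Q})_{P,Q\in\mathrm{SYT}(\lambda)}$ is defined by $n_Q=\sum_PA_{P,Q}v_P$ in $\mathbb{S}_m^\lambda$, where $\mathbb{S}_m^\lambda$ has seminormal basis $\{v_P\mid P\in\mathrm{SYT}(\lambda)\}$ with action $s_iv_P=a_i(P)v_P+(1+a_i(P))v_{s_i(P)}$ ($v_{s_i(P)}=0$ if nonstandard), and $n_Q=w_Qv_{C_\lambda}$, with $C_\lambda$ the column reading tableau of shape $\lambda$ and $w_Q\in\mathbb{S}_m$ such that $w_Q(C_\lambda)=Q$. $\mathcal{A}_\emptyset=(1)$. *)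

theory Defs
  imports Complex_Main "HOL-Algebra.Sym_Groups" "HOL-Algebra.Group_Action"
begin

section \<open>Partitions and tableaux\<close>

text \<open>
  Components, rows and columns are indexed from 0, entries from 1.  A box is a pair
  (row, column); contents are differences, so they do not depend on the offset.
  A partition is the list of its parts; its size is \<^term>\<open>sum_list\<close>.
\<close>

type_synonym filling = "nat \<times> nat \<Rightarrow> nat"

definition is_partition :: "nat list \<Rightarrow> bool" where
  "is_partition lam \<longleftrightarrow> sorted_wrt (\<ge>) lam \<and> 0 \<notin> set lam"

definition rsize :: "nat list list \<Rightarrow> nat" where
  "rsize lams = sum_list (map sum_list lams)"

definition r_partition :: "nat \<Rightarrow> nat \<Rightarrow> nat list list \<Rightarrow> bool" where
  "r_partition r n lams \<longleftrightarrow>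
     length lams = r \<and> (\<forall>lam\<in>set lams. is_partition lam) \<and> rsize lams = n"

definition diagram :: "nat list \<Rightarrow> (nat \<times> nat) set" where
  "diagram lam = {(x, y). x < length lam \<and> y < lam ! x}"

definition increasing :: "nat list \<Rightarrow> filling \<Rightarrow> bool" where
  "increasing lam t \<longleftrightarrow>
     (\<forall>x y y'. (x, y) \<in> diagram lam \<longrightarrow> (x, y') \<in> diagram lam \<longrightarrow> y < y' \<longrightarrow> t (x, y) < t (x, y')) \<and>
     (\<forall>x x' y. (x, y) \<in> diagram lam \<longrightarrow> (x', y) \<in> diagram lam \<longrightarrow> x < x' \<longrightarrow> t (x, y) < t (x', y))"

text \<open>
  Fillings are extensional on the diagram, so that equality of functions is equality of tableaux.
\<close>

definition SYT :: "nat list \<Rightarrow> filling set" where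
  "SYT lam = {t \<in> extensional (diagram lam).
     bij_betw t (diagram lam) {1..sum_list lam} \<and> increasing lam t}"

definition r_tableaux :: "nat list list \<Rightarrow> filling list set" where
  "r_tableaux lams = {T. length T = length lams \<and>
     (\<forall>k<length lams. T ! k \<in> extensional (diagram (lams ! k))) \<and>
     bij_betw (\<lambda>(k, b). (T ! k) b) (SIGMA k:{..<length lams}. diagram (lams ! k)) {1..rsize lams}}"

definition rSYT :: "nat list list \<Rightarrow> filling list set" where
  "rSYT lams = {T \<in> r_tableaux lams. \<forall>k<length lams. increasing (lams ! k) (T ! k)}"

definition entries :: "nat list \<Rightarrow> filling \<Rightarrow> nat set" where
  "entries lam t = t ` diagram lam"

definition act :: "nat list \<Rightarrow> (nat \<Rightarrow> nat) \<Rightarrow> filling \<Rightarrow> filling" where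
  "act lam \<sigma> t = (\<lambda>b\<in>diagram lam. \<sigma> (t b))"

definition ract :: "nat list list \<Rightarrow> (nat \<Rightarrow> nat) \<Rightarrow> filling list \<Rightarrow> filling list" where
  "ract lams \<sigma> T = map2 (\<lambda>lam t. act lam \<sigma> t) lams T"

definition column_height :: "nat list \<Rightarrow> nat \<Rightarrow> nat" where
  "column_height lam y = card {x. (x, y) \<in> diagram lam}"

definition column_reading :: "nat list \<Rightarrow> filling" where
  "column_reading lam = (\<lambda>(x, y)\<in>diagram lam. (\<Sum>y'<y. column_height lam y') + x + 1)"

definition rcolumn_reading :: "nat list list \<Rightarrow> filling list" where
  "rcolumn_reading lams =
     map (\<lambda>k. \<lambda>b\<in>diagram (lams ! k). (\<Sum>j<k. sum_list (lams ! j)) + column_reading (lams ! k) b)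
       [0..<length lams]"

definition w_perm :: "nat list \<Rightarrow> filling \<Rightarrow> nat \<Rightarrow> nat" where
  "w_perm lam t = (THE \<sigma>. \<sigma> permutes {1..sum_list lam} \<and> act lam \<sigma> (column_reading lam) = t)"

definition rw_perm :: "nat list list \<Rightarrow> filling list \<Rightarrow> nat \<Rightarrow> nat" where
  "rw_perm lams T = (THE \<sigma>. \<sigma> permutes {1..rsize lams} \<and> ract lams \<sigma> (rcolumn_reading lams) = T)"

definition alphabet :: "nat list list \<Rightarrow> filling list \<Rightarrow> nat set list" where
  "alphabet lams T = map2 entries lams T"

text \<open>Ordered set partitions whose \<open>k\<close>-th block (possibly empty) has the size of the
  \<open>k\<close>-th component.\<close>

definition alphabets :: "nat list list \<Rightarrow> nat set list set" where
  "alphabets lams = {B. length B = length lams \<and>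
     (\<forall>j<length B. \<forall>k<length B. j \<noteq> k \<longrightarrow> B ! j \<inter> B ! k = {}) \<and>
     \<Union> (set B) = {1..rsize lams} \<and>
     (\<forall>k<length B. card (B ! k) = sum_list (lams ! k))}"

text \<open>Order-preserving relabeling replaces an entry by its rank among the entries of its
  component.\<close>

definition standardize :: "nat list \<Rightarrow> filling \<Rightarrow> filling" where
  "standardize lam t = (\<lambda>b\<in>diagram lam. card {j \<in> entries lam t. j \<le> t b})"

definition relabel :: "nat list list \<Rightarrow> filling list \<Rightarrow> filling list" where
  "relabel lams T = map2 standardize lams T"

definition ct :: "nat \<times> nat \<Rightarrow> int" where
  "ct = (\<lambda>(x, y). int y - int x)"

definition box_of :: "nat list \<Rightarrow> filling \<Rightarrow> nat \<Rightarrow> nat \<times> nat" where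
  "box_of lam t i = (THE b. b \<in> diagram lam \<and> t b = i)"

definition a_coeff :: "nat list \<Rightarrow> filling \<Rightarrow> nat \<Rightarrow> complex" where
  "a_coeff lam t i = 1 / of_int (ct (box_of lam t (Suc i)) - ct (box_of lam t i))"

section \<open>The groups\<close>

text \<open>
  The wreath product of the integers modulo \<open>r\<close> with the symmetric group on \<open>{1..n}\<close>: the pair
  \<open>(c, \<sigma>)\<close> is the element with colours \<open>c\<close> times \<open>\<sigma>\<close>.
\<close>

definition wreath :: "nat \<Rightarrow> nat \<Rightarrow> ((nat \<Rightarrow> nat) \<times> (nat \<Rightarrow> nat)) monoid" where
  "wreath r n =
     \<lparr>carrier = ({1..n} \<rightarrow>\<^sub>E {0..<r}) \<times> {\<sigma>. \<sigma> permutes {1..n}},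
      mult = (\<lambda>(c, \<sigma>) (d, \<tau>). (\<lambda>i\<in>{1..n}. (c i + d (inv' \<sigma> i)) mod r, \<sigma> \<circ> \<tau>)),
      one = (\<lambda>i\<in>{1..n}. 0, id)\<rparr>"

definition adj :: "nat \<Rightarrow> nat \<Rightarrow> nat" where
  "adj i = Transposition.transpose i (Suc i)"

definition emb :: "nat \<Rightarrow> (nat \<Rightarrow> nat) \<Rightarrow> (nat \<Rightarrow> nat) \<times> (nat \<Rightarrow> nat)" where
  "emb n \<sigma> = (\<lambda>i\<in>{1..n}. 0, \<sigma>)"

definition gen :: "nat \<Rightarrow> nat \<Rightarrow> nat \<Rightarrow> (nat \<Rightarrow> nat) \<times> (nat \<Rightarrow> nat)" where
  "gen r n i = (if i = 0 then (\<lambda>j\<in>{1..n}. if j = 1 then 1 mod r else 0, id) else emb n (adj i))"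

lemma wreath_simps:
  "carrier (wreath r n) = ({1..n} \<rightarrow>\<^sub>E {0..<r}) \<times> {\<sigma>. \<sigma> permutes {1..n}}"
  "(c, \<sigma>) \<otimes>\<^bsub>wreath r n\<^esub> (d, \<tau>) = (\<lambda>i\<in>{1..n}. (c i + d (inv' \<sigma> i)) mod r, \<sigma> \<circ> \<tau>)"
  "\<one>\<^bsub>wreath r n\<^esub> = (\<lambda>i\<in>{1..n}. 0, id)"
  by (simp_all add: wreath_def)

lemma permutes_inv_in: "\<sigma> permutes S \<Longrightarrow> inv' \<sigma> x \<in> S \<longleftrightarrow> x \<in> S"
  by (meson permutes_in_image permutes_inv)

lemma wreath_group:
  assumes "r > 0"
  shows "group (wreath r n)"
proof (rule groupI)
  fix x y assume "x \<in> carrier (wreath r n)" "y \<in> carrier (wreath r n)"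
  then show "x \<otimes>\<^bsub>wreath r n\<^esub> y \<in> carrier (wreath r n)"
    using assms by (cases x, cases y) (auto simp: wreath_simps permutes_compose)
next
  show "\<one>\<^bsub>wreath r n\<^esub> \<in> carrier (wreath r n)"
    using assms by (auto simp: wreath_simps permutes_id)
next
  fix x y z
  assume xyz: "x \<in> carrier (wreath r n)" "y \<in> carrier (wreath r n)" "z \<in> carrier (wreath r n)"
  obtain c \<sigma> d \<tau> e \<upsilon> where eq: "x = (c, \<sigma>)" "y = (d, \<tau>)" "z = (e, \<upsilon>)"
    by (metis surj_pair)
  have p: "\<sigma> permutes {1..n}" "\<tau> permutes {1..n}"
    using xyz eq by (auto simp: wreath_simps)
  have i: "inv' (\<sigma> \<circ> \<tau>) = inv' \<tau> \<circ> inv' \<sigma>"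
    using p by (intro o_inv_distrib) (auto simp: permutes_bij)
  show "x \<otimes>\<^bsub>wreath r n\<^esub> y \<otimes>\<^bsub>wreath r n\<^esub> z = x \<otimes>\<^bsub>wreath r n\<^esub> (y \<otimes>\<^bsub>wreath r n\<^esub> z)"
    unfolding eq wreath_simps i
    using permutes_inv_in[OF p(1)]
    by (auto simp: fun_eq_iff restrict_def mod_simps add.assoc)
next
  fix x assume "x \<in> carrier (wreath r n)"
  then show "\<one>\<^bsub>wreath r n\<^esub> \<otimes>\<^bsub>wreath r n\<^esub> x = x"
    by (cases x) (auto simp: wreath_simps fun_eq_iff PiE_def extensional_def Pi_def)
next
  fix x assume x: "x \<in> carrier (wreath r n)"
  obtain c \<sigma> where eq: "x = (c, \<sigma>)" by (cases x)
  have p: "\<sigma> permutes {1..n}" and c: "c \<in> {1..n} \<rightarrow>\<^sub>E {0..<r}"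
    using x eq by (auto simp: wreath_simps)
  define d where "d = (\<lambda>i\<in>{1..n}. (r - c (\<sigma> i)) mod r)"
  have "(d, inv' \<sigma>) \<in> carrier (wreath r n)"
    using assms p by (auto simp: wreath_simps d_def permutes_inv)
  moreover have "((r - c j) mod r + c j) mod r = 0" if "j \<in> {1..n}" for j
  proof -
    have "c j < r" using c that by auto
    then show ?thesis by (simp add: mod_simps)
  qed
  then have "(d, inv' \<sigma>) \<otimes>\<^bsub>wreath r n\<^esub> x = \<one>\<^bsub>wreath r n\<^esub>"
    using p permutes_in_image[OF p]
    by (auto simp: eq wreath_simps d_def fun_eq_iff restrict_def permutes_inv_o
          permutes_inv_inv permutes_inverses)
  ultimately show "\<exists>y\<in>carrier (wreath r n). y \<otimes>\<^bsub>wreath r n\<^esub> x = \<one>\<^bsub>wreath r n\<^esub>" by blast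
qed

lemma emb_mult:
  assumes "\<sigma> permutes {1..n}"
  shows "emb n \<sigma> \<otimes>\<^bsub>wreath r n\<^esub> emb n \<tau> = emb n (\<sigma> \<circ> \<tau>)"
  using permutes_inv_in[OF assms] by (auto simp: emb_def wreath_simps restrict_def fun_eq_iff)

text \<open>The generators satisfy the defining relations of the standard presentation (with braid relation
  of length four between \<open>s\<^sub>0\<close> and \<open>s\<^sub>1\<close>).\<close>

lemma gen_in_carrier:
  assumes "r > 0" "i < n"
  shows "gen r n i \<in> carrier (wreath r n)"
  using assms
  by (auto simp: gen_def emb_def adj_def wreath_simps intro!: permutes_swap_id permutes_id)

lemma gen_relations:
  assumes "r > 0"
  shows "\<lbrakk>i < n; j < n; Suc i < j\<rbrakk> \<Longrightarrow>
           gen r n i \<otimes>\<^bsub>wreath r n\<^esub> gen r n j = gen r n j \<otimes>\<^bsub>wreath r n\<^esub> gen r n i"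
    and "\<lbrakk>1 \<le> i; Suc i < n\<rbrakk> \<Longrightarrow>
           gen r n i \<otimes>\<^bsub>wreath r n\<^esub> gen r n (Suc i) \<otimes>\<^bsub>wreath r n\<^esub> gen r n i =
           gen r n (Suc i) \<otimes>\<^bsub>wreath r n\<^esub> gen r n i \<otimes>\<^bsub>wreath r n\<^esub> gen r n (Suc i)"
    and "1 < n \<Longrightarrow>
           gen r n 0 \<otimes>\<^bsub>wreath r n\<^esub> gen r n 1 \<otimes>\<^bsub>wreath r n\<^esub> gen r n 0 \<otimes>\<^bsub>wreath r n\<^esub> gen r n 1 =
           gen r n 1 \<otimes>\<^bsub>wreath r n\<^esub> gen r n 0 \<otimes>\<^bsub>wreath r n\<^esub> gen r n 1 \<otimes>\<^bsub>wreath r n\<^esub> gen r n 0"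
    and "\<lbrakk>1 \<le> i; i < n\<rbrakk> \<Longrightarrow> gen r n i \<otimes>\<^bsub>wreath r n\<^esub> gen r n i = \<one>\<^bsub>wreath r n\<^esub>"
    and "0 < n \<Longrightarrow> gen r n 0 [^]\<^bsub>wreath r n\<^esub> r = \<one>\<^bsub>wreath r n\<^esub>"
proof -
  have inv_adj [simp]: "inv' (adj k) = adj k" for k
    by (simp add: adj_def)
  have inv_adj2 [simp]: "inv' (adj k \<circ> adj l) = adj l \<circ> adj k" for k l
    by (subst o_inv_distrib) (auto simp: adj_def)
  have adj2 [simp]: "adj k \<circ> adj k = id" for k
    by (auto simp: adj_def)
  show "gen r n i \<otimes>\<^bsub>wreath r n\<^esub> gen r n j = gen r n j \<otimes>\<^bsub>wreath r n\<^esub> gen r n i"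
    if "i < n" "j < n" "Suc i < j"
    using that assms
    by (auto simp: gen_def emb_def wreath_simps fun_eq_iff adj_def Transposition.transpose_def)
  show "gen r n i \<otimes>\<^bsub>wreath r n\<^esub> gen r n (Suc i) \<otimes>\<^bsub>wreath r n\<^esub> gen r n i =
        gen r n (Suc i) \<otimes>\<^bsub>wreath r n\<^esub> gen r n i \<otimes>\<^bsub>wreath r n\<^esub> gen r n (Suc i)"
    if "1 \<le> i" "Suc i < n"
  proof -
    have p: "adj i permutes {1..n}" "adj (Suc i) permutes {1..n}"
      using that by (auto simp: adj_def intro!: permutes_swap_id)
    have "adj i \<circ> adj (Suc i) \<circ> adj i = adj (Suc i) \<circ> adj i \<circ> adj (Suc i)"
      by (auto simp: fun_eq_iff adj_def Transposition.transpose_def)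
    then show ?thesis
      using that p by (simp add: gen_def emb_mult permutes_compose)
  qed
  show "gen r n i \<otimes>\<^bsub>wreath r n\<^esub> gen r n i = \<one>\<^bsub>wreath r n\<^esub>" if "1 \<le> i" "i < n"
    using that assms
    by (auto simp: gen_def emb_def wreath_simps fun_eq_iff adj_def Transposition.transpose_def)
  show "gen r n 0 \<otimes>\<^bsub>wreath r n\<^esub> gen r n 1 \<otimes>\<^bsub>wreath r n\<^esub> gen r n 0 \<otimes>\<^bsub>wreath r n\<^esub> gen r n 1 =
        gen r n 1 \<otimes>\<^bsub>wreath r n\<^esub> gen r n 0 \<otimes>\<^bsub>wreath r n\<^esub> gen r n 1 \<otimes>\<^bsub>wreath r n\<^esub> gen r n 0"
    if n: "1 < n"
  proof -
    interpret W: group "wreath r n" using assms by (rule wreath_group)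
    have c: "gen r n 0 \<in> carrier (wreath r n)" "gen r n 1 \<in> carrier (wreath r n)"
      using n assms by (auto intro!: gen_in_carrier)
    have *: "gen r n 0 \<otimes>\<^bsub>wreath r n\<^esub> gen r n 1 =
             (\<lambda>j\<in>{1..n}. if j = 1 then 1 mod r else 0, adj 1)"
      by (auto simp: gen_def emb_def wreath_simps fun_eq_iff restrict_def)
    have **: "gen r n 1 \<otimes>\<^bsub>wreath r n\<^esub> gen r n 0 =
              (\<lambda>j\<in>{1..n}. if j = 2 then 1 mod r else 0, adj 1)"
      using n by (auto simp: gen_def emb_def wreath_simps fun_eq_iff restrict_def adj_def
          Transposition.transpose_def)
    have "(gen r n 0 \<otimes>\<^bsub>wreath r n\<^esub> gen r n 1) \<otimes>\<^bsub>wreath r n\<^esub> (gen r n 0 \<otimes>\<^bsub>wreath r n\<^esub> gen r n 1) =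
          (gen r n 1 \<otimes>\<^bsub>wreath r n\<^esub> gen r n 0) \<otimes>\<^bsub>wreath r n\<^esub> (gen r n 1 \<otimes>\<^bsub>wreath r n\<^esub> gen r n 0)"
      unfolding * ** using n
      by (auto simp: wreath_simps fun_eq_iff adj_def Transposition.transpose_def)
    with c show ?thesis by (simp add: W.m_assoc)
  qed
  have "gen r n 0 [^]\<^bsub>wreath r n\<^esub> k = (\<lambda>j\<in>{1..n}. if j = 1 then k mod r else 0, id)" for k :: nat
    by (induction k)
       (auto simp: wreath_simps gen_def fun_eq_iff restrict_def mod_simps add.commute)
  then show "gen r n 0 [^]\<^bsub>wreath r n\<^esub> r = \<one>\<^bsub>wreath r n\<^esub>"
    by (auto simp: wreath_simps fun_eq_iff)
qed

section \<open>The modules\<close>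

text \<open>
  The complex vector space with basis \<open>X\<close> consists of the functions supported on \<open>X\<close>;
  \<open>bvec X T\<close> is the basis vector of \<open>T\<close>, and 0 if \<open>T\<close> is not in \<open>X\<close>.
\<close>

definition free_space :: "'t set \<Rightarrow> ('t \<Rightarrow> complex) set" where
  "free_space X = {f. \<forall>T. T \<notin> X \<longrightarrow> f T = 0}"

definition bvec :: "'t set \<Rightarrow> 't \<Rightarrow> 't \<Rightarrow> complex" where
  "bvec X T = (\<lambda>U. if T \<in> X \<and> U = T then 1 else 0)"

definition representation ::
    "('g, 'm) monoid_scheme \<Rightarrow> 't set \<Rightarrow> ('g \<Rightarrow> ('t \<Rightarrow> complex) \<Rightarrow> 't \<Rightarrow> complex) \<Rightarrow> bool" where
  "representation G X \<rho> \<longleftrightarrow>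
     group_action G (free_space X) \<rho> \<and>
     (\<forall>g\<in>carrier G. \<forall>x\<in>free_space X. \<forall>y\<in>free_space X. \<forall>c d.
        \<rho> g (\<lambda>U. c * x U + d * y U) = (\<lambda>U. c * \<rho> g x U + d * \<rho> g y U))"

definition sym_seminormal_module ::
    "nat list \<Rightarrow> ((nat \<Rightarrow> nat) \<Rightarrow> (filling \<Rightarrow> complex) \<Rightarrow> filling \<Rightarrow> complex) \<Rightarrow> bool" where
  "sym_seminormal_module lam \<rho> \<longleftrightarrow>
     representation (sym_group (sum_list lam)) (SYT lam) \<rho> \<and>
     (\<forall>t\<in>SYT lam. \<forall>i. 1 \<le> i \<and> i < sum_list lam \<longrightarrow>
        \<rho> (adj i) (bvec (SYT lam) t) =
          (\<lambda>U. a_coeff lam t i * bvec (SYT lam) t U +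
               (1 + a_coeff lam t i) * bvec (SYT lam) (act lam (adj i) t) U))"

definition sym_natural ::
    "nat list \<Rightarrow> ((nat \<Rightarrow> nat) \<Rightarrow> (filling \<Rightarrow> complex) \<Rightarrow> filling \<Rightarrow> complex) \<Rightarrow>
     filling \<Rightarrow> filling \<Rightarrow> complex" where
  "sym_natural lam \<rho> t = \<rho> (w_perm lam t) (bvec (SYT lam) (column_reading lam))"

definition primitive_root_of_unity :: "nat \<Rightarrow> complex \<Rightarrow> bool" where
  "primitive_root_of_unity r \<xi> \<longleftrightarrow> 0 < r \<and> \<xi> ^ r = 1 \<and> (\<forall>k. 0 < k \<and> k < r \<longrightarrow> \<xi> ^ k \<noteq> 1)"

text \<open>Component \<open>k\<close> here is component \<open>k + 1\<close> in one-based numbering, so \<open>s\<^sub>0\<close> acts by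
  \<open>\<xi> ^ k\<close>.\<close>

definition wreath_seminormal_module ::
    "nat \<Rightarrow> complex \<Rightarrow> nat list list \<Rightarrow>
     ((nat \<Rightarrow> nat) \<times> (nat \<Rightarrow> nat) \<Rightarrow> (filling list \<Rightarrow> complex) \<Rightarrow> filling list \<Rightarrow> complex) \<Rightarrow> bool" where
  "wreath_seminormal_module n \<xi> lams \<rho> \<longleftrightarrow>
     (let r = length lams; X = rSYT lams in
      representation (wreath r n) X \<rho> \<and>
      (\<forall>T\<in>X. \<forall>k<r. 1 \<in> entries (lams ! k) (T ! k) \<longrightarrow>
         \<rho> (gen r n 0) (bvec X T) = (\<lambda>U. \<xi> ^ k * bvec X T U)) \<and>
      (\<forall>T\<in>X. \<forall>i. 1 \<le> i \<and> i < n \<longrightarrow>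
         (\<forall>k<r. \<forall>l<r. i \<in> entries (lams ! k) (T ! k) \<and> Suc i \<in> entries (lams ! l) (T ! l) \<longrightarrow>
            \<rho> (gen r n i) (bvec X T) =
              (if k \<noteq> l then bvec X (ract lams (adj i) T)
               else (\<lambda>U. a_coeff (lams ! k) (T ! k) i * bvec X T U +
                         (1 + a_coeff (lams ! k) (T ! k) i) * bvec X (ract lams (adj i) T) U)))))"

definition wreath_natural ::
    "nat \<Rightarrow> nat list list \<Rightarrow>
     ((nat \<Rightarrow> nat) \<times> (nat \<Rightarrow> nat) \<Rightarrow> (filling list \<Rightarrow> complex) \<Rightarrow> filling list \<Rightarrow> complex) \<Rightarrow>
     filling list \<Rightarrow> filling list \<Rightarrow> complex" where
  "wreath_natural n lams \<rho> T =
     \<rho> (emb n (rw_perm lams T)) (bvec (rSYT lams) (rcolumn_reading lams))"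

section \<open>Matrices\<close>

text \<open>Matrices are functions of a row and a column index; only entries indexed by \<open>X\<close> matter.\<close>

definition transition_matrix ::
    "'t set \<Rightarrow> ('t \<Rightarrow> 't \<Rightarrow> complex) \<Rightarrow> ('t \<Rightarrow> 't \<Rightarrow> complex) \<Rightarrow> ('t \<Rightarrow> 't \<Rightarrow> complex) \<Rightarrow> bool" where
  "transition_matrix X v nat_basis A \<longleftrightarrow>
     (\<forall>T\<in>X. nat_basis T = (\<lambda>U. \<Sum>S\<in>X. A S T * v S U))"

definition tensor_matrix :: "('t \<Rightarrow> 't \<Rightarrow> complex) list \<Rightarrow> 't list \<Rightarrow> 't list \<Rightarrow> complex" where
  "tensor_matrix Ms P Q = (\<Prod>k<length Ms. (Ms ! k) (P ! k) (Q ! k))"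

text \<open>Direct sum of copies of one matrix; the first index component names the copy.\<close>

definition direct_sum_copies :: "('i \<Rightarrow> 'i \<Rightarrow> complex) \<Rightarrow> 'b \<times> 'i \<Rightarrow> 'b \<times> 'i \<Rightarrow> complex" where
  "direct_sum_copies M = (\<lambda>(b, i) (b', j). if b = b' then M i j else 0)"

end

theory Submission
  imports Defs
begin

text \<open>
  Restricted to the symmetric group, the module of an \<open>r\<close>-partition is induced from the tensor product
  of the symmetric group modules of its components, the summands of the induced module being
  indexed by the alphabets. Everything follows from making this explicit in the seminormal basis.

  A standard \<open>r\<close>-tableau is the same as an alphabet together with a standard tableau for each
  component, its relabeling (\<open>bij_betw_alphabet_relabel\<close>). A permutation \<open>\<sigma>\<close> sends a block \<open>B\<close> of the
  alphabet to \<open>\<sigma> ` B\<close>; reading off ranks in both blocks gives an induced permutation of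
  \<open>{1..card B}\<close>. The central lemma \<open>wreath_action_eq_tensor_action\<close> says that \<open>\<sigma>\<close> moves the alphabet
  and acts on the tensor factors through the induced permutations. It is proved by multiplying \<open>\<sigma>\<close> on
  the right by simple reflections: when \<open>i\<close> and \<open>Suc i\<close> lie in different components, the seminormal
  formula permutes basis vectors and no relative order changes (\<open>tensor_action_adj_different\<close>); when
  they lie in the same component, they have consecutive ranks there, their contents are unaffected
  by relabeling, and the formula is the seminormal formula in that tensor factor
  (\<open>tensor_action_adj_same\<close>).

  The natural basis vector of \<open>T\<close> arises by applying to the column reading tableau the permutation
  that carries it to \<open>T\<close>. In each component this permutation induces the one that carries the column
  reading tableau of that shape to the relabeled component of \<open>T\<close> (\<open>w_perm_relabel\<close>). So the
  natural basis vector of \<open>T\<close> lies in the summand of its alphabet and is there the tensor product of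
  the natural basis vectors of the relabeled components, and its coordinates are products of the
  entries of the symmetric group transition matrices. The number of copies is the number of
  alphabets, a multinomial coefficient (\<open>card_alphabets\<close>).
\<close>

section \<open>Permutations of intervals\<close>

text \<open>
  Multiplying on the right is what the action of the group needs: for a product \<open>\<sigma> \<circ> adj i\<close> the
  simple reflection reaches a basis vector first, and there its effect is prescribed.
\<close>

lemma permutes_adj_induct [consumes 1, case_names id adj]:
  assumes "\<sigma> permutes {1..n}"
    and "P id"
    and step: "\<And>\<sigma> i. \<sigma> permutes {1..n} \<Longrightarrow> P \<sigma> \<Longrightarrow> 1 \<le> i \<Longrightarrow> i < n \<Longrightarrow> P (\<sigma> \<circ> adj i)"
  shows "P \<sigma>"
  using finite_atLeastAtMost assms(1,2)
proof (induction rule: permutes_rev_induct)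
  case (swap a b p)
  have closed: "p \<circ> apply_adj_transps is permutes {1..n} \<and> P (p \<circ> apply_adj_transps is)"
    if "set is \<subseteq> {1..<n}" for "is"
    using that
  proof (induction "is" rule: rev_induct)
    case (snoc i "is")
    then have "set is \<subseteq> {1..<n}" "1 \<le> i" "i < n" by auto
    then have "p \<circ> apply_adj_transps is permutes {1..n}" "P (p \<circ> apply_adj_transps is)" "1 \<le> i" "i < n"
      using snoc.IH by blast+
    moreover have "adj i permutes {1..n}"
      using snoc.prems by (auto simp: adj_def intro!: permutes_swap_id)
    moreover have "apply_adj_transps (is @ [i]) = apply_adj_transps is \<circ> adj i"
      by (simp add: adj_def)
    ultimately show ?case
      using step[of "p \<circ> apply_adj_transps is" i]
        permutes_compose[of "adj i" "{1..n}" "p \<circ> apply_adj_transps is"]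
      by (simp only: o_assoc)
  qed (use swap in auto)
  have "P (p \<circ> Transposition.transpose a b)" if "a < b" "a \<in> {1..n}" "b \<in> {1..n}" for a b
  proof -
    have "set (adj_transp_seq a b) \<subseteq> {1..<n}"
      using that by (auto simp: set_adj_transp_seq)
    from closed[OF this] show ?thesis
      using that by (simp add: adj_transp_seq_correct)
  qed
  then show ?case
    using swap by (metis Transposition.transpose_commute linorder_neqE_nat)
qed

text \<open>
  This is the reason why a tableau determines the permutation that carries the column reading
  tableau to it; \<open>D\<close> is the set of boxes.
\<close>

lemma ex1_permutes_matching:
  assumes f: "bij_betw f D S" and g: "bij_betw g D S"
  shows "\<exists>!\<sigma>. \<sigma> permutes S \<and> (\<forall>d\<in>D. \<sigma> (f d) = g d)"
proof (rule ex1I)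
  let ?\<sigma> = "\<lambda>x. if x \<in> S then g (inv_into D f x) else x"
  have "bij_betw (g \<circ> inv_into D f) S S"
    using bij_betw_inv_into[OF f] g by (rule bij_betw_trans)
  then have "bij_betw ?\<sigma> S S"
    by (rule bij_betw_cong[THEN iffD1, rotated]) auto
  then have "?\<sigma> permutes S"
    by (rule bij_imp_permutes) auto
  moreover have "?\<sigma> (f d) = g d" if "d \<in> D" for d
    using f that by (auto simp: bij_betw_def)
  ultimately show "?\<sigma> permutes S \<and> (\<forall>d\<in>D. ?\<sigma> (f d) = g d)" by blast
  fix \<tau> assume \<tau>: "\<tau> permutes S \<and> (\<forall>d\<in>D. \<tau> (f d) = g d)"
  show "\<tau> = ?\<sigma>"
  proof
    fix x show "\<tau> x = ?\<sigma> x"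
      using \<tau> f by (auto simp: bij_betw_def f_inv_into_f inv_into_into permutes_not_in)
  qed
qed

section \<open>Ranks and the permutations they induce\<close>

definition rank_in :: "nat set \<Rightarrow> nat \<Rightarrow> nat" where
  "rank_in B x = card {j \<in> B. j \<le> x}"

lemma rank_in_less_iff:
  assumes "finite B" "x \<in> B" "y \<in> B"
  shows "rank_in B x < rank_in B y \<longleftrightarrow> x < y"
proof -
  have *: "rank_in B x < rank_in B y" if "x < y" "y \<in> B" for x y
  proof -
    have "{j \<in> B. j \<le> x} \<subset> {j \<in> B. j \<le> y}"
      using that by (auto simp: psubset_eq set_eq_iff intro!: exI[of _ y])
    then show ?thesis
      unfolding rank_in_def using assms(1) by (intro psubset_card_mono) auto
  qed
  show ?thesis using *[of x y] *[of y x] assms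
    by (metis linorder_neqE_nat order_less_asym' order_less_irrefl)
qed

lemma rank_in_inj:
  assumes "finite B" "x \<in> B" "y \<in> B"
  shows "rank_in B x = rank_in B y \<longleftrightarrow> x = y"
  using rank_in_less_iff[OF assms] rank_in_less_iff[OF assms(1,3,2)] by auto

lemma bij_betw_rank_in:
  assumes "finite B"
  shows "bij_betw (rank_in B) B {1..card B}"
proof -
  have inj: "inj_on (rank_in B) B"
    using assms by (auto intro!: inj_onI simp: rank_in_inj)
  have "rank_in B ` B \<subseteq> {1..card B}"
  proof clarify
    fix x assume "x \<in> B"
    then have "{j \<in> B. j \<le> x} \<noteq> {}" by auto
    then show "rank_in B x \<in> {1..card B}"
      unfolding rank_in_def using assms
      by (auto simp: Suc_le_eq card_gt_0_iff intro!: card_mono)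
  qed
  then have "rank_in B ` B = {1..card B}"
    using inj by (intro card_subset_eq) (auto simp: card_image)
  with inj show ?thesis by (simp add: bij_betw_def)
qed

lemma rank_in_range: "finite B \<Longrightarrow> x \<in> B \<Longrightarrow> rank_in B x \<in> {1..card B}"
  using bij_betwE[OF bij_betw_rank_in] by blast

lemma rank_in_interval: "x \<in> {Suc a..a + m} \<Longrightarrow> rank_in {Suc a..a + m} x = x - a"
proof -
  assume "x \<in> {Suc a..a + m}"
  then have "{j \<in> {Suc a..a + m}. j \<le> x} = {Suc a..x}" by auto
  then show ?thesis by (simp add: rank_in_def)
qed

lemma rank_in_Suc:
  assumes "finite B" "Suc i \<in> B"
  shows "rank_in B (Suc i) = Suc (rank_in B i)"
proof -
  have "{j \<in> B. j \<le> Suc i} = insert (Suc i) {j \<in> B. j \<le> i}"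
    using assms by (auto simp: le_Suc_eq)
  then show ?thesis using assms by (simp add: rank_in_def)
qed

text \<open>
  A permutation \<open>\<sigma>\<close> maps \<open>B\<close> onto \<open>\<sigma> ` B\<close>; after both sets are identified with
  \<open>{1..card B}\<close> by their order, it becomes a permutation of that interval, the identity exactly
  when \<open>\<sigma>\<close> is increasing on \<open>B\<close>.
\<close>

definition induced :: "(nat \<Rightarrow> nat) \<Rightarrow> nat set \<Rightarrow> nat \<Rightarrow> nat" where
  "induced \<sigma> B j =
     (if j \<in> {1..card B} then rank_in (\<sigma> ` B) (\<sigma> (inv_into B (rank_in B) j)) else j)"

lemma induced_rank_in:
  assumes "finite B" "x \<in> B"
  shows "induced \<sigma> B (rank_in B x) = rank_in (\<sigma> ` B) (\<sigma> x)"
  using assms bij_betw_rank_in[OF assms(1)] rank_in_range[OF assms]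
  by (auto simp: induced_def bij_betw_def)

lemma inducedI:
  assumes "finite B" "\<And>x. x \<in> B \<Longrightarrow> \<pi> (rank_in B x) = rank_in (\<sigma> ` B) (\<sigma> x)"
    and "\<And>j. j \<notin> {1..card B} \<Longrightarrow> \<pi> j = j"
  shows "induced \<sigma> B = \<pi>"
proof
  fix j show "induced \<sigma> B j = \<pi> j"
  proof (cases "j \<in> {1..card B}")
    case True
    then obtain x where "x \<in> B" "j = rank_in B x"
      using bij_betw_imp_surj_on[OF bij_betw_rank_in[OF assms(1)]] by (metis imageE)
    then show ?thesis using assms by (simp add: induced_rank_in)
  next
    case False
    then show ?thesis using assms(3)[OF False] unfolding induced_def by argo
  qed
qed

lemma induced_permutes:
  assumes "finite B" "inj \<sigma>"
  shows "induced \<sigma> B permutes {1..card B}"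
proof (rule bij_imp_permutes)
  have c: "card (\<sigma> ` B) = card B"
    using assms by (meson card_image inj_on_subset subset_UNIV)
  have "bij_betw (inv_into B (rank_in B)) {1..card B} B"
    using bij_betw_inv_into[OF bij_betw_rank_in] assms by blast
  moreover have "bij_betw \<sigma> B (\<sigma> ` B)"
    using assms by (meson bij_betw_def inj_on_subset subset_UNIV)
  moreover have "bij_betw (rank_in (\<sigma> ` B)) (\<sigma> ` B) {1..card B}"
    using bij_betw_rank_in[of "\<sigma> ` B"] assms c by simp
  ultimately have "bij_betw (rank_in (\<sigma> ` B) \<circ> (\<sigma> \<circ> inv_into B (rank_in B))) {1..card B} {1..card B}"
    by (blast intro: bij_betw_trans)
  then show "bij_betw (induced \<sigma> B) {1..card B} {1..card B}"
    by (rule bij_betw_cong[THEN iffD1, rotated]) (auto simp: induced_def)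
qed (auto simp: induced_def)

lemma induced_id: "finite B \<Longrightarrow> induced id B = id"
  by (rule inducedI) auto

text \<open>
  The cocycle rule: the outer permutation sees the block after the inner one has moved it.
\<close>

lemma induced_comp:
  assumes "finite B" "inj \<tau>"
  shows "induced (\<sigma> \<circ> \<tau>) B = induced \<sigma> (\<tau> ` B) \<circ> induced \<tau> B"
proof (rule inducedI)
  fix x assume "x \<in> B"
  then show "(induced \<sigma> (\<tau> ` B) \<circ> induced \<tau> B) (rank_in B x) = rank_in ((\<sigma> \<circ> \<tau>) ` B) ((\<sigma> \<circ> \<tau>) x)"
    using assms by (simp add: induced_rank_in image_comp)
next
  fix j assume "j \<notin> {1..card B}"
  moreover have "card (\<tau> ` B) = card B"
    using assms by (meson card_image inj_on_subset subset_UNIV)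
  ultimately show "(induced \<sigma> (\<tau> ` B) \<circ> induced \<tau> B) j = j"
    by (simp add: induced_def del: atLeastAtMost_iff)
qed fact

lemma inj_adj: "inj (adj i)"
  by (simp add: adj_def)

text \<open>
  Since no integer lies between \<open>i\<close> and \<open>Suc i\<close>, they have consecutive ranks in a set that contains
  both of them.
\<close>

lemma induced_adj_same:
  assumes "finite B" "i \<in> B" "Suc i \<in> B"
  shows "induced (adj i) B = adj (rank_in B i)" "adj i ` B = B"
proof -
  show B: "adj i ` B = B"
    using assms by (simp add: adj_def)
  have S: "rank_in B (Suc i) = Suc (rank_in B i)"
    using assms by (simp add: rank_in_Suc)
  have "rank_in B i \<in> {1..card B}" "Suc (rank_in B i) \<in> {1..card B}"
    using rank_in_range[OF assms(1,2)] rank_in_range[OF assms(1,3)] S by auto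
  moreover have "adj (rank_in B i) (rank_in B x) = rank_in (adj i ` B) (adj i x)" if "x \<in> B" for x
    unfolding B
    using S rank_in_inj[OF assms(1) that assms(2)] rank_in_inj[OF assms(1) that assms(3)]
    by (cases "x = i"; cases "x = Suc i") (simp_all add: adj_def)
  ultimately show "induced (adj i) B = adj (rank_in B i)"
    using assms(1) by (intro inducedI) (auto simp: adj_def Transposition.transpose_def)
qed

lemma rank_in_adj:
  assumes "finite B" "x \<in> B" "\<not> (i \<in> B \<and> Suc i \<in> B)"
  shows "rank_in (adj i ` B) (adj i x) = rank_in B x"
proof -
  have "{j \<in> adj i ` B. j \<le> adj i x} = adj i ` {j \<in> B. j \<le> x}"
  proof -
    have "adj i j \<le> adj i x \<longleftrightarrow> j \<le> x" if "j \<in> B" for j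
      using assms that by (auto simp: adj_def Transposition.transpose_def le_Suc_eq not_le less_Suc_eq)
    then show ?thesis by auto
  qed
  then show ?thesis
    unfolding rank_in_def by (simp add: card_image inj_adj inj_on_subset[OF inj_adj])
qed

text \<open>
  Exchanging \<open>i\<close> and \<open>Suc i\<close> can only disturb the order of a set that contains both of them.
\<close>

lemma induced_adj_different:
  assumes "finite B" "\<not> (i \<in> B \<and> Suc i \<in> B)"
  shows "induced (adj i) B = id"
  using assms by (intro inducedI) (auto simp: rank_in_adj)

section \<open>Single components\<close>

text \<open>
  Standardness with an arbitrary set of entries: this is what a component of a standard
  \<open>r\<close>-tableau satisfies.
\<close>

definition standard_filling :: "nat list \<Rightarrow> filling \<Rightarrow> bool" where
  "standard_filling lam t \<longleftrightarrow>
     t \<in> extensional (diagram lam) \<and> inj_on t (diagram lam) \<and> increasing lam t"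

lemma finite_diagram [simp]: "finite (diagram lam)"
  and card_diagram: "card (diagram lam) = sum_list lam"
proof -
  have eq: "diagram lam = (SIGMA x:{..<length lam}. {..<lam ! x})"
    by (auto simp: diagram_def)
  show "finite (diagram lam)" unfolding eq by auto
  show "card (diagram lam) = sum_list lam"
    unfolding eq by (simp add: card_SigmaI sum_list_sum_nth atLeast0LessThan)
qed

lemma finite_entries [simp]: "finite (entries lam t)"
  by (simp add: entries_def)

lemma card_entries: "inj_on t (diagram lam) \<Longrightarrow> card (entries lam t) = sum_list lam"
  by (simp add: entries_def card_image card_diagram)

lemma SYT_iff:
  "t \<in> SYT lam \<longleftrightarrow> standard_filling lam t \<and> entries lam t = {1..sum_list lam}"
  by (auto simp: SYT_def standard_filling_def bij_betw_def entries_def)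

lemma standardize_rank_in:
  "standardize lam t = (\<lambda>b\<in>diagram lam. rank_in (entries lam t) (t b))"
  by (simp add: standardize_def rank_in_def)

lemma inj_standardize:
  "inj_on t (diagram lam) \<Longrightarrow> inj_on (standardize lam t) (diagram lam)"
  by (auto simp: inj_on_def standardize_rank_in rank_in_inj entries_def)

lemma entries_standardize:
  assumes "inj_on t (diagram lam)"
  shows "entries lam (standardize lam t) = {1..sum_list lam}"
proof -
  have "entries lam (standardize lam t) = rank_in (entries lam t) ` entries lam t"
    by (auto simp: standardize_rank_in entries_def)
  also have "\<dots> = {1..sum_list lam}"
    using bij_betw_rank_in[of "entries lam t"] card_entries[OF assms]
    by (simp add: bij_betw_def)
  finally show ?thesis .
qed

lemma standardize_less_iff:
  assumes "b \<in> diagram lam" "b' \<in> diagram lam"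
  shows "standardize lam t b < standardize lam t b' \<longleftrightarrow> t b < t b'"
  using assms by (auto simp: standardize_rank_in rank_in_less_iff entries_def)

lemma increasing_standardize: "increasing lam (standardize lam t) \<longleftrightarrow> increasing lam t"
  unfolding increasing_def by (simp add: standardize_less_iff cong: conj_cong)

text \<open>
  Ranks compare as the entries do, so relabeling neither creates nor destroys standardness.
\<close>

lemma standardize_SYT_iff:
  assumes "t \<in> extensional (diagram lam)" "inj_on t (diagram lam)"
  shows "standardize lam t \<in> SYT lam \<longleftrightarrow> standard_filling lam t"
proof -
  have "standardize lam t \<in> extensional (diagram lam)"
    by (simp add: standardize_rank_in)
  then show ?thesis
    using assms inj_standardize entries_standardize
    by (simp add: SYT_iff standard_filling_def increasing_standardize)
qed

lemma standardize_inj: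
  assumes "standard_filling lam t" "standard_filling lam t'"
    and "entries lam t = entries lam t'" "standardize lam t = standardize lam t'"
  shows "t = t'"
proof (rule extensionalityI)
  fix b assume b: "b \<in> diagram lam"
  then have "rank_in (entries lam t) (t b) = rank_in (entries lam t) (t' b)"
    using fun_cong[OF assms(4), of b] assms(3) by (simp add: standardize_rank_in)
  moreover have "t b \<in> entries lam t" "t' b \<in> entries lam t"
    using b assms(3) by (auto simp: entries_def)
  ultimately show "t b = t' b" by (simp add: rank_in_inj)
qed (use assms in \<open>auto simp: standard_filling_def\<close>)

text \<open>
  The preimage of \<open>p\<close> has the \<open>p b\<close>-th smallest element of \<open>B\<close> in the box \<open>b\<close>.
\<close>

lemma standardize_surj:
  assumes "p \<in> SYT lam" "finite B" "card B = sum_list lam"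
  obtains t where "standard_filling lam t" "entries lam t = B" "standardize lam t = p"
proof
  let ?u = "inv_into B (rank_in B)"
  let ?t = "\<lambda>b\<in>diagram lam. ?u (p b)"
  have p: "p \<in> extensional (diagram lam)" "inj_on p (diagram lam)" "p ` diagram lam = {1..card B}"
    using assms by (auto simp: SYT_def bij_betw_def)
  have u: "bij_betw ?u {1..card B} B"
    using bij_betw_inv_into[OF bij_betw_rank_in] assms by blast
  show E: "entries lam ?t = B"
  proof -
    have "entries lam ?t = ?u ` p ` diagram lam" by (auto simp: entries_def)
    then show ?thesis using p u by (simp add: bij_betw_def)
  qed
  have r: "rank_in B (?u (p b)) = p b" if "b \<in> diagram lam" for b
    using bij_betw_rank_in[OF assms(2)] p(3) that
    by (metis bij_betw_imp_surj_on f_inv_into_f imageI)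
  show S: "standardize lam ?t = p"
    unfolding standardize_rank_in E using p(1) r by (auto simp: fun_eq_iff extensional_def)
  have "inj_on ?t (diagram lam)"
  proof (rule inj_onI)
    fix b b' assume "b \<in> diagram lam" "b' \<in> diagram lam" "?t b = ?t b'"
    then have "p b = p b'" using r by (metis restrict_apply')
    then show "b = b'" using inj_onD[OF p(2)] \<open>b \<in> _\<close> \<open>b' \<in> _\<close> by blast
  qed
  then show "standard_filling lam ?t"
    using standardize_SYT_iff[of ?t lam] S assms by simp
qed

lemma act_simps: "b \<in> diagram lam \<Longrightarrow> act lam \<sigma> t b = \<sigma> (t b)"
  "act lam \<sigma> t \<in> extensional (diagram lam)"
  by (auto simp: act_def)

lemma entries_act: "entries lam (act lam \<sigma> t) = \<sigma> ` entries lam t"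
  by (auto simp: entries_def act_simps)

lemma inj_on_act:
  assumes "inj \<sigma>" "inj_on t (diagram lam)"
  shows "inj_on (act lam \<sigma> t) (diagram lam)"
  using assms by (auto simp: inj_on_def act_simps)

lemma standardize_act:
  "standardize lam (act lam \<sigma> t) = act lam (induced \<sigma> (entries lam t)) (standardize lam t)"
proof
  fix b
  show "standardize lam (act lam \<sigma> t) b =
        act lam (induced \<sigma> (entries lam t)) (standardize lam t) b"
  proof (cases "b \<in> diagram lam")
    case True
    then have "t b \<in> entries lam t" by (simp add: entries_def)
    then show ?thesis
      using True by (simp add: standardize_rank_in act_simps entries_act induced_rank_in)
  next
    case False
    then show ?thesis by (simp add: standardize_rank_in act_def)
  qed
qed

lemma box_of_standardize:
  assumes "inj_on t (diagram lam)" "i \<in> entries lam t"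
  shows "box_of lam (standardize lam t) (rank_in (entries lam t) i) = box_of lam t i"
proof -
  have "(b \<in> diagram lam \<and> standardize lam t b = rank_in (entries lam t) i) \<longleftrightarrow>
        (b \<in> diagram lam \<and> t b = i)" for b
    using assms by (auto simp: standardize_rank_in rank_in_inj entries_def)
  then show ?thesis unfolding box_of_def by simp
qed

text \<open>
  The coefficient depends on the two boxes only, and relabeling moves no entry to another box.
\<close>

lemma a_coeff_standardize:
  assumes "inj_on t (diagram lam)" "i \<in> entries lam t" "Suc i \<in> entries lam t"
  shows "a_coeff lam (standardize lam t) (rank_in (entries lam t) i) = a_coeff lam t i"
  unfolding a_coeff_def
  using assms box_of_standardize[OF assms(1,2)] box_of_standardize[OF assms(1,3)]
  by (simp add: rank_in_Suc)

lemma act_id: "t \<in> extensional (diagram lam) \<Longrightarrow> act lam id t = t"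
  by (auto simp: act_def extensional_def)

subsection \<open>The column reading tableau\<close>

text \<open>
  Because the parts decrease, every column of the diagram is an initial segment of rows.
\<close>

lemma column_of_diagram:
  assumes "is_partition lam"
  shows "{x. (x, y) \<in> diagram lam} = {..<column_height lam y}"
proof -
  let ?X = "{x. (x, y) \<in> diagram lam}"
  have "finite ?X" by (rule finite_subset[of _ "{..<length lam}"]) (auto simp: diagram_def)
  have down: "x' \<in> ?X" if "x \<in> ?X" "x' \<le> x" for x x'
  proof (cases "x' = x")
    case False
    then have "lam ! x \<le> lam ! x'"
      using that assms by (auto simp: is_partition_def diagram_def sorted_wrt_iff_nth_less)
    then show ?thesis using that by (auto simp: diagram_def)
  qed (use that in auto)
  show ?thesis
  proof (cases "?X = {}")
    case False
    define m where "m = Max ?X"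
    have "m \<in> ?X" unfolding m_def by (rule Max_in) fact+
    moreover have "x \<le> m" if "x \<in> ?X" for x
      unfolding m_def using that \<open>finite ?X\<close> by (intro Max_ge) auto
    ultimately have "x \<in> ?X \<longleftrightarrow> x \<in> {..<Suc m}" for x
      using down[of m x] by (auto simp only: lessThan_iff less_Suc_eq_le)
    then have "?X = {..<Suc m}" by blast
    then show ?thesis unfolding column_height_def by simp
  qed (simp add: column_height_def)
qed

lemma column_reading_less:
  assumes "is_partition lam" "(x, y) \<in> diagram lam" "(x', y') \<in> diagram lam" "y < y'"
  shows "column_reading lam (x, y) < column_reading lam (x', y')"
proof -
  have "x < column_height lam y"
    using column_of_diagram[OF assms(1), of y] assms(2) by auto
  moreover have "(\<Sum>j<Suc y. column_height lam j) \<le> (\<Sum>j<y'. column_height lam j)"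
    using assms(4) by (intro sum_mono2) auto
  ultimately show ?thesis using assms by (simp add: column_reading_def)
qed

text \<open>
  Entries grow from one column to the next, so the filling is injective; each value is bounded by
  the total height of the columns read so far, hence by the number of boxes, and counting makes
  the filling bijective.
\<close>

lemma column_reading_SYT:
  assumes "is_partition lam"
  shows "column_reading lam \<in> SYT lam"
proof -
  let ?c = "column_reading lam"
  have inj: "inj_on ?c (diagram lam)"
  proof (rule inj_onI)
    fix b b' assume *: "b \<in> diagram lam" "b' \<in> diagram lam" "?c b = ?c b'"
    obtain x y x' y' where b: "b = (x, y)" "b' = (x', y')" by (metis surj_pair)
    have "y = y'"
      using * b column_reading_less[OF assms, of x y x' y'] column_reading_less[OF assms, of x' y' x y]
      by (cases y y' rule: linorder_cases) auto
    then show "b = b'" using * b by (simp add: column_reading_def)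
  qed
  have "?c b \<in> {1..sum_list lam}" if b: "b \<in> diagram lam" for b
  proof -
    obtain x y where xy: "b = (x, y)" by (cases b)
    have "x < column_height lam y"
      using column_of_diagram[OF assms, of y] b xy by auto
    then have "?c b \<le> (\<Sum>j<Suc y. column_height lam j)"
      using b xy by (simp add: column_reading_def)
    also have "\<dots> = card (SIGMA j:{..<Suc y}. {x. (x, j) \<in> diagram lam})"
      unfolding column_height_def
      by (subst card_SigmaI) (auto simp: column_of_diagram[OF assms])
    also have "\<dots> = card (prod.swap ` (SIGMA j:{..<Suc y}. {x. (x, j) \<in> diagram lam}))"
      by (simp add: card_image)
    also have "\<dots> \<le> card (diagram lam)"
      by (rule card_mono) auto
    finally show ?thesis using b xy by (simp add: card_diagram column_reading_def)
  qed
  then have "?c ` diagram lam = {1..sum_list lam}"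
    using inj by (intro card_subset_eq) (auto simp: card_image card_diagram)
  moreover have "?c (x, y) < ?c (x', y)"
    if "(x, y) \<in> diagram lam" "(x', y) \<in> diagram lam" "x < x'" for x x' y
    using that by (simp add: column_reading_def)
  then have "increasing lam ?c"
    unfolding increasing_def using column_reading_less[OF assms] by blast
  moreover have "?c \<in> extensional (diagram lam)" by (simp add: column_reading_def)
  ultimately show ?thesis using inj by (simp add: SYT_def bij_betw_def)
qed

lemma w_perm_eqI:
  assumes "is_partition lam" "\<pi> permutes {1..sum_list lam}"
    and "act lam \<pi> (column_reading lam) = t"
  shows "w_perm lam t = \<pi>"
  unfolding w_perm_def
proof (rule the_equality)
  fix \<tau> assume \<tau>: "\<tau> permutes {1..sum_list lam} \<and> act lam \<tau> (column_reading lam) = t"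
  let ?c = "column_reading lam"
  have c: "bij_betw ?c (diagram lam) {1..sum_list lam}"
    using column_reading_SYT[OF assms(1)] by (simp add: SYT_def)
  have "bij_betw (\<pi> \<circ> ?c) (diagram lam) {1..sum_list lam}"
    using c permutes_imp_bij[OF assms(2)] by (rule bij_betw_trans)
  from ex1_permutes_matching[OF c this] have *: "\<exists>!\<sigma>. \<sigma> permutes {1..sum_list lam} \<and> (\<forall>b\<in>diagram lam. \<sigma> (?c b) = \<pi> (?c b))"
    by simp
  have "\<tau> (?c b) = \<pi> (?c b)" if "b \<in> diagram lam" for b
    using \<tau> assms(3) that by (metis act_simps(1))
  then show "\<tau> = \<pi>" using * \<tau> assms(2) by (blast elim!: ex1E)
qed (use assms in simp)

section \<open>Tableaux with several components\<close>

lemma component_nth [simp]: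
  assumes "length T = length lams" "k < length lams"
  shows "alphabet lams T ! k = entries (lams ! k) (T ! k)"
    and "relabel lams T ! k = standardize (lams ! k) (T ! k)"
    and "ract lams \<sigma> T ! k = act (lams ! k) \<sigma> (T ! k)"
  using assms by (simp_all add: alphabet_def relabel_def ract_def)

lemma component_length [simp]:
  assumes "length T = length lams"
  shows "length (alphabet lams T) = length lams"
    and "length (relabel lams T) = length lams"
    and "length (ract lams \<sigma> T) = length lams"
  using assms by (simp_all add: alphabet_def relabel_def ract_def)

lemma alphabets_iff:
  "B \<in> alphabets lams \<longleftrightarrow> length B = length lams \<and>
     (\<forall>j<length lams. \<forall>k<length lams. j \<noteq> k \<longrightarrow> B ! j \<inter> B ! k = {}) \<and>
     (\<Union>k<length lams. B ! k) = {1..rsize lams} \<and>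
     (\<forall>k<length lams. card (B ! k) = sum_list (lams ! k))"
proof -
  have "\<Union> (set B) = (\<Union>k<length B. B ! k)"
    by (force simp: set_conv_nth)
  then show ?thesis by (simp add: alphabets_def cong: conj_cong)
qed

lemma alphabets_image:
  assumes "B \<in> alphabets lams" "\<sigma> permutes {1..rsize lams}"
  shows "map (image \<sigma>) B \<in> alphabets lams"
proof -
  have inj: "inj \<sigma>" using assms(2) by (rule permutes_inj)
  have "\<sigma> ` X \<inter> \<sigma> ` Y = {}" if "X \<inter> Y = {}" for X Y
    using that by (simp flip: image_Int[OF inj])
  moreover have "(\<Union>k<length lams. \<sigma> ` (B ! k)) = {1..rsize lams}"
    using assms permutes_image[OF assms(2)] by (simp add: alphabets_iff flip: image_UN)
  moreover have "card (\<sigma> ` X) = card X" for X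
    using inj by (meson card_image inj_on_subset subset_UNIV)
  ultimately show ?thesis
    using assms(1) by (auto simp: alphabets_iff)
qed

text \<open>
  A standard \<open>r\<close>-tableau is a tuple of standard fillings whose sets of entries form an alphabet: a
  filling of the disjoint union of the diagrams is bijective when every component is injective
  and the images partition the interval.
\<close>

lemma rSYT_iff:
  "T \<in> rSYT lams \<longleftrightarrow> length T = length lams \<and>
     (\<forall>k<length lams. standard_filling (lams ! k) (T ! k)) \<and> alphabet lams T \<in> alphabets lams"
proof (cases "length T = length lams")
  case len: True
  let ?r = "length lams"
  let ?D = "SIGMA k:{..<?r}. diagram (lams ! k)"
  let ?f = "\<lambda>(k, b). (T ! k) b"
  have im: "?f ` ?D = (\<Union>k<?r. alphabet lams T ! k)"
    using len by (force simp: entries_def)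
  have inj: "inj_on ?f ?D \<longleftrightarrow> (\<forall>k<?r. inj_on (T ! k) (diagram (lams ! k))) \<and>
      (\<forall>j<?r. \<forall>k<?r. j \<noteq> k \<longrightarrow> alphabet lams T ! j \<inter> alphabet lams T ! k = {})" (is "?L \<longleftrightarrow> ?R")
  proof
    assume L: ?L
    have "b = b'" if "k < ?r" "b \<in> diagram (lams ! k)" "b' \<in> diagram (lams ! k)"
      "(T ! k) b = (T ! k) b'" for k b b'
      using inj_onD[OF L, of "(k, b)" "(k, b')"] that by simp
    moreover have "j = k" if "j < ?r" "k < ?r" "b \<in> diagram (lams ! j)" "b' \<in> diagram (lams ! k)"
      "(T ! j) b = (T ! k) b'" for j k b b'
      using inj_onD[OF L, of "(j, b)" "(k, b')"] that by simp
    ultimately show ?R using len by (fastforce simp: entries_def inj_on_def)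
  next
    assume R: ?R
    show ?L
    proof (rule inj_onI)
      fix p q assume "p \<in> ?D" "q \<in> ?D" "?f p = ?f q"
      then obtain j b k c where p: "p = (j, b)" "q = (k, c)" "j < ?r" "k < ?r"
        "b \<in> diagram (lams ! j)" "c \<in> diagram (lams ! k)" "(T ! j) b = (T ! k) c" by auto
      then have "j = k"
        using R len by (fastforce simp: entries_def)
      then show "p = q" using p R by (auto dest: inj_onD)
    qed
  qed
  have "T \<in> rSYT lams \<longleftrightarrow> (\<forall>k<?r. T ! k \<in> extensional (diagram (lams ! k))) \<and>
      (inj_on ?f ?D \<and> ?f ` ?D = {1..rsize lams}) \<and> (\<forall>k<?r. increasing (lams ! k) (T ! k))"
    using len by (simp add: rSYT_def r_tableaux_def bij_betw_def)
  also have "\<dots> \<longleftrightarrow> (\<forall>k<?r. standard_filling (lams ! k) (T ! k)) \<and> alphabet lams T \<in> alphabets lams"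
    unfolding inj im alphabets_iff standard_filling_def
    using len card_entries by auto
  finally show ?thesis using len by simp
qed (simp add: rSYT_def r_tableaux_def)

lemma rSYT_D:
  assumes "T \<in> rSYT lams"
  shows "length T = length lams"
    and "k < length lams \<Longrightarrow> standard_filling (lams ! k) (T ! k)"
    and "k < length lams \<Longrightarrow> T ! k \<in> extensional (diagram (lams ! k))"
    and "k < length lams \<Longrightarrow> inj_on (T ! k) (diagram (lams ! k))"
    and "k < length lams \<Longrightarrow> card (entries (lams ! k) (T ! k)) = sum_list (lams ! k)"
    and "k < length lams \<Longrightarrow> standardize (lams ! k) (T ! k) \<in> SYT (lams ! k)"
    and "alphabet lams T \<in> alphabets lams"
  using assms card_entries
  by (auto simp: rSYT_iff standard_filling_def standardize_SYT_iff)

lemma in_listset_iff: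
  "xs \<in> listset As \<longleftrightarrow> length xs = length As \<and> (\<forall>k<length As. xs ! k \<in> As ! k)"
proof (induction As arbitrary: xs)
  case (Cons A As)
  then show ?case
    by (cases xs) (auto simp: set_Cons_def All_less_Suc2)
qed simp

lemma alphabet_relabel_inj:
  assumes "S \<in> rSYT lams" "T \<in> rSYT lams"
    and "alphabet lams S = alphabet lams T" "relabel lams S = relabel lams T"
  shows "S = T"
proof (rule nth_equalityI)
  fix k assume "k < length S"
  then have k: "k < length lams" using assms by (simp add: rSYT_iff)
  note len = rSYT_D(1)[OF assms(1)] rSYT_D(1)[OF assms(2)]
  have "entries (lams ! k) (S ! k) = entries (lams ! k) (T ! k)"
    "standardize (lams ! k) (S ! k) = standardize (lams ! k) (T ! k)"
    using assms(3,4) component_nth(1,2)[OF len(1) k] component_nth(1,2)[OF len(2) k] by simp_all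
  then show "S ! k = T ! k"
    by (rule standardize_inj[OF rSYT_D(2)[OF assms(1) k] rSYT_D(2)[OF assms(2) k]])
qed (use assms in \<open>simp add: rSYT_iff\<close>)

text \<open>
  A component is determined by its set of entries and the relative order of these entries, and both
  can be prescribed freely in every component.
\<close>

lemma bij_betw_alphabet_relabel:
  "bij_betw (\<lambda>T. (alphabet lams T, relabel lams T)) (rSYT lams)
     (alphabets lams \<times> listset (map SYT lams))"
  unfolding bij_betw_def
proof (intro conjI inj_onI equalityI subsetI)
  fix S T assume "S \<in> rSYT lams" "T \<in> rSYT lams"
    "(alphabet lams S, relabel lams S) = (alphabet lams T, relabel lams T)"
  then show "S = T" using alphabet_relabel_inj by blast
next
  fix p assume "p \<in> (\<lambda>T. (alphabet lams T, relabel lams T)) ` rSYT lams"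
  then show "p \<in> alphabets lams \<times> listset (map SYT lams)"
    by (auto simp: in_listset_iff rSYT_D)
next
  fix p assume "p \<in> alphabets lams \<times> listset (map SYT lams)"
  then obtain B P where p: "p = (B, P)" "B \<in> alphabets lams"
    and P: "length P = length lams" "\<forall>k<length lams. P ! k \<in> SYT (lams ! k)"
    by (auto simp: in_listset_iff)
  have "\<exists>t. k < length lams \<longrightarrow> standard_filling (lams ! k) t \<and>
          entries (lams ! k) t = B ! k \<and> standardize (lams ! k) t = P ! k" for k
  proof (cases "k < length lams")
    case True
    then have "B ! k \<subseteq> (\<Union>k<length lams. B ! k)" by blast
    then have "finite (B ! k)" "card (B ! k) = sum_list (lams ! k)"
      using p(2) True by (auto simp: alphabets_iff intro: finite_subset)
    then show ?thesis using standardize_surj[of "P ! k"] P(2) True by metis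
  qed simp
  then obtain t where t: "\<And>k. k < length lams \<Longrightarrow> standard_filling (lams ! k) (t k) \<and>
          entries (lams ! k) (t k) = B ! k \<and> standardize (lams ! k) (t k) = P ! k"
    by metis
  let ?T = "map t [0..<length lams]"
  have "alphabet lams ?T = B"
    using t p by (intro nth_equalityI) (auto simp: alphabets_iff)
  moreover have "relabel lams ?T = P"
    using t P by (intro nth_equalityI) auto
  ultimately have "?T \<in> rSYT lams" "p = (alphabet lams ?T, relabel lams ?T)"
    using t p by (auto simp: rSYT_iff)
  then show "p \<in> (\<lambda>T. (alphabet lams T, relabel lams T)) ` rSYT lams" by blast
qed

subsection \<open>Permuting the entries\<close>

lemma alphabet_ract:
  "length T = length lams \<Longrightarrow> alphabet lams (ract lams \<sigma> T) = map (image \<sigma>) (alphabet lams T)"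
  by (rule nth_equalityI) (auto simp: entries_act)

lemma relabel_ract_nth:
  assumes "length T = length lams" "k < length lams"
  shows "relabel lams (ract lams \<sigma> T) ! k =
    act (lams ! k) (induced \<sigma> (entries (lams ! k) (T ! k))) (relabel lams T ! k)"
  using assms by (simp add: standardize_act)

text \<open>
  Permuting the entries of an \<open>r\<close>-tableau moves the alphabet and acts on the relabeled components by
  the induced permutations; standardness is visible on the latter.
\<close>

lemma ract_rSYT_iff:
  assumes "T \<in> rSYT lams" "\<sigma> permutes {1..rsize lams}"
  shows "ract lams \<sigma> T \<in> rSYT lams \<longleftrightarrow>
    (\<forall>k<length lams. act (lams ! k) (induced \<sigma> (entries (lams ! k) (T ! k))) (relabel lams T ! k)
       \<in> SYT (lams ! k))"
proof -
  have "standard_filling (lams ! k) (act (lams ! k) \<sigma> (T ! k)) \<longleftrightarrow>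
     act (lams ! k) (induced \<sigma> (entries (lams ! k) (T ! k))) (relabel lams T ! k) \<in> SYT (lams ! k)"
    if "k < length lams" for k
  proof -
    have "inj_on (act (lams ! k) \<sigma> (T ! k)) (diagram (lams ! k))"
      using permutes_inj[OF assms(2)] rSYT_D(4)[OF assms(1) that] by (rule inj_on_act)
    from standardize_SYT_iff[OF act_simps(2) this] show ?thesis
      using rSYT_D(1)[OF assms(1)] that by (simp add: standardize_act)
  qed
  then show ?thesis
    using alphabets_image[OF rSYT_D(7)[OF assms(1)] assms(2)] rSYT_D(1)[OF assms(1)]
    unfolding rSYT_iff[of "ract lams \<sigma> T"] by (simp add: alphabet_ract)
qed

subsection \<open>The column reading tableau\<close>

lemma rcolumn_reading_nth:
  assumes "k < length lams"
  shows "rcolumn_reading lams ! k =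
    act (lams ! k) (\<lambda>x. (\<Sum>j<k. sum_list (lams ! j)) + x) (column_reading (lams ! k))"
  using assms by (simp add: rcolumn_reading_def act_def)

lemma length_rcolumn_reading [simp]: "length (rcolumn_reading lams) = length lams"
  by (simp add: rcolumn_reading_def)

lemma shift_interval: "(\<lambda>x. a + x) ` {1..m} = {Suc a..a + m}" for a m :: nat
  by (auto simp: image_iff intro!: bexI[of _ "_ - a"])

text \<open>
  Component \<open>k\<close> of the column reading tableau is a shift of the column reading tableau of its shape
  by the number of boxes to the left, which leaves the ranks unchanged.
\<close>

lemma rcolumn_reading_props:
  assumes "\<forall>lam\<in>set lams. is_partition lam"
  shows "rcolumn_reading lams \<in> rSYT lams"
    and "k < length lams \<Longrightarrow> relabel lams (rcolumn_reading lams) ! k = column_reading (lams ! k)"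
proof -
  define off where "off k = (\<Sum>j<k. sum_list (lams ! j))" for k
  let ?C = "rcolumn_reading lams"
  have C: "?C ! k = act (lams ! k) (\<lambda>x. off k + x) (column_reading (lams ! k))" if "k < length lams" for k
    using rcolumn_reading_nth[OF that] by (simp add: off_def)
  have c: "column_reading (lams ! k) \<in> SYT (lams ! k)" if "k < length lams" for k
    using assms column_reading_SYT that by simp
  have E: "entries (lams ! k) (?C ! k) = {Suc (off k)..off k + sum_list (lams ! k)}"
    if "k < length lams" for k
    using C[OF that] c[OF that] by (simp add: entries_act SYT_iff shift_interval del: One_nat_def)
  have std: "standardize (lams ! k) (?C ! k) = column_reading (lams ! k)" if k: "k < length lams" for k
  proof
    fix b
    have "column_reading (lams ! k) b \<in> {1..sum_list (lams ! k)}" if "b \<in> diagram (lams ! k)"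
      using c[OF k] that by (auto simp: SYT_iff entries_def)
    then show "standardize (lams ! k) (?C ! k) b = column_reading (lams ! k) b"
      unfolding standardize_rank_in E[OF k] using C[OF k]
      by (cases "b \<in> diagram (lams ! k)")
         (auto simp: act_simps rank_in_interval column_reading_def)
  qed
  have sf: "standard_filling (lams ! k) (?C ! k)" if "k < length lams" for k
  proof -
    have "inj_on (?C ! k) (diagram (lams ! k))"
      using C[OF that] c[OF that] by (simp add: inj_on_act SYT_iff standard_filling_def)
    moreover have "?C ! k \<in> extensional (diagram (lams ! k))"
      using C[OF that] by (simp add: act_simps)
    ultimately show ?thesis
      using standardize_SYT_iff std[OF that] c[OF that] by metis
  qed
  have mono: "off j + sum_list (lams ! j) \<le> off k" if "j < k" for j k
  proof -
    have "(\<Sum>i<Suc j. sum_list (lams ! i)) \<le> (\<Sum>i<k. sum_list (lams ! i))"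
      using that by (intro sum_mono2) auto
    then show ?thesis by (simp add: off_def)
  qed
  have disj: "{Suc (off j)..off j + sum_list (lams ! j)} \<inter> {Suc (off k)..off k + sum_list (lams ! k)} = {}"
    if "j \<noteq> k" for j k
    using mono[of j k] mono[of k j] that by (cases j k rule: linorder_cases) auto
  have un: "(\<Union>k<m. {Suc (off k)..off k + sum_list (lams ! k)}) = {1..off m}" for m
  proof (induction m)
    case (Suc m)
    have "off (Suc m) = off m + sum_list (lams ! m)" by (simp add: off_def)
    then show ?case using Suc by (auto simp: lessThan_Suc)
  qed (simp add: off_def)
  have "off (length lams) = rsize lams"
    by (simp add: off_def rsize_def sum_list_sum_nth atLeast0LessThan)
  then have "alphabet lams ?C \<in> alphabets lams"
    using disj un[of "length lams"] E by (simp add: alphabets_iff)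
  then show "?C \<in> rSYT lams" using sf by (simp add: rSYT_iff)
  show "relabel lams ?C ! k = column_reading (lams ! k)" if "k < length lams"
    using std that by simp
qed

lemma ract_eq_iff:
  assumes "length S = length lams" "length T = length lams"
    and "\<And>k. k < length lams \<Longrightarrow> T ! k \<in> extensional (diagram (lams ! k))"
  shows "ract lams \<sigma> S = T \<longleftrightarrow>
    (\<forall>(k, b) \<in> (SIGMA k:{..<length lams}. diagram (lams ! k)). \<sigma> ((S ! k) b) = (T ! k) b)"
proof -
  have "ract lams \<sigma> S = T \<longleftrightarrow> (\<forall>k<length lams. act (lams ! k) \<sigma> (S ! k) = T ! k)"
    using assms by (auto simp: list_eq_iff_nth_eq)
  also have "act (lams ! k) \<sigma> (S ! k) = T ! k \<longleftrightarrow> (\<forall>b\<in>diagram (lams ! k). \<sigma> ((S ! k) b) = (T ! k) b)"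
    if "k < length lams" for k
    using assms(3)[OF that] by (auto simp: act_def fun_eq_iff extensional_def)
  then have "(\<forall>k<length lams. act (lams ! k) \<sigma> (S ! k) = T ! k) \<longleftrightarrow>
     (\<forall>k<length lams. \<forall>b\<in>diagram (lams ! k). \<sigma> ((S ! k) b) = (T ! k) b)" by blast
  finally show ?thesis by auto
qed

lemma rw_perm_props:
  assumes "\<forall>lam\<in>set lams. is_partition lam" "T \<in> rSYT lams"
  shows "rw_perm lams T permutes {1..rsize lams}"
    and "ract lams (rw_perm lams T) (rcolumn_reading lams) = T"
proof -
  let ?C = "rcolumn_reading lams" and ?D = "SIGMA k:{..<length lams}. diagram (lams ! k)"
  have "bij_betw (\<lambda>(k, b). (?C ! k) b) ?D {1..rsize lams}"
    "bij_betw (\<lambda>(k, b). (T ! k) b) ?D {1..rsize lams}"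
    using rcolumn_reading_props(1)[OF assms(1)] assms(2) by (simp_all add: rSYT_def r_tableaux_def)
  from ex1_permutes_matching[OF this]
  have "\<exists>!\<sigma>. \<sigma> permutes {1..rsize lams} \<and> (\<forall>(k, b)\<in>?D. \<sigma> ((?C ! k) b) = (T ! k) b)"
    by (simp add: case_prod_beta)
  then have "\<exists>!\<sigma>. \<sigma> permutes {1..rsize lams} \<and> ract lams \<sigma> ?C = T"
    using ract_eq_iff[of ?C lams T] rSYT_D[OF assms(2)] by simp
  from theI'[OF this] show "rw_perm lams T permutes {1..rsize lams}" "ract lams (rw_perm lams T) ?C = T"
    by (simp_all add: rw_perm_def)
qed

text \<open>
  The permutation that carries the column reading \<open>r\<close>-tableau to \<open>T\<close> induces, on the entries of every
  component, the permutation that defines the natural basis vector of the relabeled component. This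
  links the natural bases of the two kinds of modules.
\<close>

lemma w_perm_relabel:
  assumes "\<forall>lam\<in>set lams. is_partition lam" "T \<in> rSYT lams" "k < length lams"
  shows "w_perm (lams ! k) (relabel lams T ! k) =
    induced (rw_perm lams T) (entries (lams ! k) (rcolumn_reading lams ! k))"
proof (rule w_perm_eqI)
  let ?C = "rcolumn_reading lams" and ?w = "rw_perm lams T"
  note C = rcolumn_reading_props[OF assms(1)]
  show "induced ?w (entries (lams ! k) (?C ! k)) permutes {1..sum_list (lams ! k)}"
    using induced_permutes[of "entries (lams ! k) (?C ! k)" ?w]
      permutes_inj[OF rw_perm_props(1)[OF assms(1,2)]] rSYT_D(5)[OF C(1) assms(3)] by simp
  show "act (lams ! k) (induced ?w (entries (lams ! k) (?C ! k))) (column_reading (lams ! k)) =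
        relabel lams T ! k"
    using relabel_ract_nth[of ?C lams k ?w] rw_perm_props(2)[OF assms(1,2)] C(2)[OF assms(3)] assms(3)
    by simp
qed (use assms in simp)

section \<open>Counting alphabets\<close>

text \<open>
  The block sizes \<open>ms\<close> and the underlying set are free parameters here, because the count removes one
  block at a time.
\<close>

definition ordered_partitions :: "nat list \<Rightarrow> 'a set \<Rightarrow> 'a set list set" where
  "ordered_partitions ms S = {B. length B = length ms \<and>
     (\<forall>j<length B. \<forall>k<length B. j \<noteq> k \<longrightarrow> B ! j \<inter> B ! k = {}) \<and>
     \<Union> (set B) = S \<and> (\<forall>k<length B. card (B ! k) = ms ! k)}"

lemma Cons_ordered_partitions_iff:
  "X # B \<in> ordered_partitions (m # ms) S \<longleftrightarrow>
     X \<subseteq> S \<and> card X = m \<and> B \<in> ordered_partitions ms (S - X)"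
proof -
  have disj: "(\<forall>j<length (X # B). \<forall>k<length (X # B). j \<noteq> k \<longrightarrow> (X # B) ! j \<inter> (X # B) ! k = {}) \<longleftrightarrow>
     (\<forall>Y\<in>set B. X \<inter> Y = {}) \<and> (\<forall>j<length B. \<forall>k<length B. j \<noteq> k \<longrightarrow> B ! j \<inter> B ! k = {})"
    by (simp add: All_less_Suc2 all_set_conv_all_nth Int_commute imp_conjR all_conj_distrib)
  have cover: "(\<forall>Y\<in>set B. X \<inter> Y = {}) \<and> X \<union> \<Union> (set B) = S \<longleftrightarrow> X \<subseteq> S \<and> \<Union> (set B) = S - X"
    by blast
  have "X # B \<in> ordered_partitions (m # ms) S \<longleftrightarrow> length B = length ms \<and>
     ((\<forall>Y\<in>set B. X \<inter> Y = {}) \<and> X \<union> \<Union> (set B) = S) \<and>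
     (\<forall>j<length B. \<forall>k<length B. j \<noteq> k \<longrightarrow> B ! j \<inter> B ! k = {}) \<and>
     card X = m \<and> (\<forall>k<length B. card (B ! k) = ms ! k)"
    unfolding ordered_partitions_def mem_Collect_eq disj by (simp add: All_less_Suc2 conj_ac)
  then show ?thesis
    unfolding cover ordered_partitions_def mem_Collect_eq by argo
qed

text \<open>
  A first block of size \<open>m\<close> can be chosen in \<open>card S choose m\<close> ways, and the number of ways to divide
  the rest depends only on its cardinality. The product form avoids division in the induction.
\<close>

lemma card_ordered_partitions:
  assumes "finite S" "sum_list ms = card S"
  shows "finite (ordered_partitions ms S) \<and>
    card (ordered_partitions ms S) * (\<Prod>k<length ms. fact (ms ! k)) = fact (card S)"
  using assms
proof (induction ms arbitrary: S)
  case Nil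
  then have "ordered_partitions [] S = {[]}"
    by (auto simp: ordered_partitions_def)
  then show ?case using Nil by simp
next
  case (Cons m ms)
  let ?K = "{X. X \<subseteq> S \<and> card X = m}"
  let ?p = "\<Prod>k<length ms. fact (ms ! k) :: nat"
  have fin: "finite X" if "X \<in> ?K" for X
    using that Cons.prems by (auto intro: finite_subset)
  have card: "card (S - X) = card S - m" if "X \<in> ?K" for X
    using that fin[OF that] by (auto simp: card_Diff_subset)
  have IH: "finite (ordered_partitions ms (S - X))"
    "card (ordered_partitions ms (S - X)) * ?p = fact (card S - m)" if "X \<in> ?K" for X
    using Cons.IH[of "S - X"] Cons.prems card[OF that] by auto
  have eq: "ordered_partitions (m # ms) S =
      (\<lambda>(X, B). X # B) ` (SIGMA X:?K. ordered_partitions ms (S - X))" (is "_ = _ ` ?P")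
  proof (intro equalityI subsetI)
    fix B assume B: "B \<in> ordered_partitions (m # ms) S"
    then obtain X B' where XB: "B = X # B'"
      by (cases B) (auto simp: ordered_partitions_def)
    with B have "(X, B') \<in> ?P" by (auto simp: Cons_ordered_partitions_iff)
    then show "B \<in> (\<lambda>(X, B). X # B) ` ?P"
      using XB by (metis (no_types, lifting) case_prod_conv image_eqI)
  qed (auto simp: Cons_ordered_partitions_iff)
  have finK: "finite ?K" using Cons.prems by simp
  then have fin_P: "finite ?P" using IH by (intro finite_SigmaI) auto
  have "card (ordered_partitions (m # ms) S) = card ?P"
    unfolding eq by (rule card_image) (auto simp: inj_on_def)
  also have "\<dots> = (\<Sum>X\<in>?K. card (ordered_partitions ms (S - X)))"
    using finK IH by (intro card_SigmaI) auto
  finally have "card (ordered_partitions (m # ms) S) * ?p = (\<Sum>X\<in>?K. fact (card S - m))"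
    using IH by (simp add: sum_distrib_right)
  also have "\<dots> = (card S choose m) * fact (card S - m)"
    using n_subsets[OF Cons.prems(1)] by simp
  finally have "card (ordered_partitions (m # ms) S) * (fact m * ?p) =
      fact m * fact (card S - m) * (card S choose m)"
    by (metis mult.assoc mult.commute)
  also have "\<dots> = fact (card S)"
    using Cons.prems by (intro binomial_fact_lemma) simp
  finally show ?case
    using fin_P eq by (simp add: prod.lessThan_Suc_shift del: prod.lessThan_Suc)
qed

lemma alphabets_eq_ordered_partitions:
  "alphabets lams = ordered_partitions (map sum_list lams) {1..rsize lams}"
  by (simp add: alphabets_def ordered_partitions_def cong: conj_cong)

lemma finite_alphabets: "finite (alphabets lams)"
  and card_alphabets_mult:
    "card (alphabets lams) * (\<Prod>k<length lams. fact (sum_list (lams ! k))) = fact (rsize lams)"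
proof -
  have "sum_list (map sum_list lams) = card {1..rsize lams}"
    by (simp add: rsize_def)
  note * = card_ordered_partitions[OF finite_atLeastAtMost this, folded alphabets_eq_ordered_partitions]
  show "finite (alphabets lams)" using * by (rule conjunct1)
  have "(\<Prod>k<length lams. fact (map sum_list lams ! k)) = (\<Prod>k<length lams. fact (sum_list (lams ! k)) :: nat)"
    by (rule prod.cong) auto
  with conjunct2[OF *]
  show "card (alphabets lams) * (\<Prod>k<length lams. fact (sum_list (lams ! k))) = fact (rsize lams)"
    by (simp only: length_map card_atLeastAtMost add_diff_cancel_right' Suc_eq_plus1)
qed

lemma card_alphabets:
  "card (alphabets lams) = fact (rsize lams) div (\<Prod>k<length lams. fact (sum_list (lams ! k)))"
proof -
  have "(\<Prod>k<length lams. fact (sum_list (lams ! k))) > (0 :: nat)"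
    by (intro prod_pos) simp
  then show ?thesis
    by (metis card_alphabets_mult less_numeral_extra(3) nonzero_mult_div_cancel_right)
qed

section \<open>Representations on free spaces\<close>

lemma representation_group_action:
  "representation G X \<rho> \<Longrightarrow> group_action G (free_space X) \<rho>"
  by (simp add: representation_def)

lemma representation_linear:
  assumes "representation G X \<rho>" "g \<in> carrier G" "x \<in> free_space X" "y \<in> free_space X"
  shows "\<rho> g (\<lambda>U. c * x U + d * y U) = (\<lambda>U. c * \<rho> g x U + d * \<rho> g y U)"
  using assms by (simp add: representation_def)

lemma bvec_free_space: "bvec X T \<in> free_space X"
  by (auto simp: bvec_def free_space_def)

lemma bvec_outside: "T \<notin> X \<Longrightarrow> bvec X T = (\<lambda>U. 0)"
  by (simp add: bvec_def)

lemma representation_bvec_outside: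
  assumes "representation G X \<rho>" "g \<in> carrier G" "T \<notin> X"
  shows "\<rho> g (bvec X T) = (\<lambda>U. 0)"
  using representation_linear[OF assms(1,2) bvec_free_space[of X T] bvec_free_space[of X T], of 0 0]
  by (simp add: bvec_outside[OF assms(3)])

text \<open>
  The actions of simple reflections on basis vectors all have the form assumed for \<open>h\<close>, where
  \<open>bvec X T'\<close> is zero if \<open>T'\<close> is not standard.
\<close>

lemma representation_mult_bvec:
  assumes "representation G X \<rho>" "g \<in> carrier G" "h \<in> carrier G"
    and "\<rho> h (bvec X T) = (\<lambda>U. c * bvec X T U + d * bvec X T' U)"
  shows "\<rho> (g \<otimes>\<^bsub>G\<^esub> h) (bvec X T) = (\<lambda>U. c * \<rho> g (bvec X T) U + d * \<rho> g (bvec X T') U)"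
  using group_action.composition_rule[OF representation_group_action[OF assms(1)] bvec_free_space assms(2,3)]
    assms(4) representation_linear[OF assms(1,2) bvec_free_space bvec_free_space]
  by simp

lemma representation_one_bvec:
  assumes "representation G X \<rho>"
  shows "\<rho> \<one>\<^bsub>G\<^esub> (bvec X T) = bvec X T"
  using fun_cong[OF group_action.id_eq_one[OF representation_group_action[OF assms]], of "bvec X T"]
  by (simp add: bvec_free_space)

lemma transition_matrix_entry:
  assumes "transition_matrix X (bvec X) N A" "finite X" "S \<in> X" "T \<in> X"
  shows "A S T = N T S"
proof -
  have "N T S = (\<Sum>R\<in>X. A R T * bvec X R S)"
    using assms(1,4) by (simp add: transition_matrix_def)
  also have "\<dots> = (\<Sum>R\<in>X. if R = S then A S T else 0)"
    by (rule sum.cong) (auto simp: bvec_def)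
  finally show ?thesis using assms by simp
qed

lemma sym_representation_mult_adj:
  assumes "sym_seminormal_module lam \<rho>" "p \<in> SYT lam" "\<pi> permutes {1..sum_list lam}"
    and "1 \<le> j" "j < sum_list lam"
  shows "\<rho> (\<pi> \<circ> adj j) (bvec (SYT lam) p) =
    (\<lambda>U. a_coeff lam p j * \<rho> \<pi> (bvec (SYT lam) p) U +
         (1 + a_coeff lam p j) * \<rho> \<pi> (bvec (SYT lam) (act lam (adj j) p)) U)"
proof -
  have "adj j permutes {1..sum_list lam}"
    using assms(4,5) by (auto simp: adj_def intro!: permutes_swap_id)
  moreover have "\<rho> (adj j) (bvec (SYT lam) p) =
      (\<lambda>U. a_coeff lam p j * bvec (SYT lam) p U +
           (1 + a_coeff lam p j) * bvec (SYT lam) (act lam (adj j) p) U)"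
    using assms by (simp add: sym_seminormal_module_def)
  ultimately show ?thesis
    using representation_mult_bvec[of "sym_group (sum_list lam)" "SYT lam" \<rho> \<pi> "adj j"] assms
    by (simp add: sym_seminormal_module_def sym_group_carrier sym_group_mult)
qed

lemma sym_representation_outside:
  assumes "sym_seminormal_module lam \<rho>" "p \<notin> SYT lam" "\<pi> permutes {1..sum_list lam}"
  shows "\<rho> \<pi> (bvec (SYT lam) p) U = 0"
  using representation_bvec_outside[of "sym_group (sum_list lam)" "SYT lam" \<rho> \<pi> p] assms
  by (simp add: sym_seminormal_module_def sym_group_carrier)

lemma sym_representation_id:
  assumes "sym_seminormal_module lam \<rho>"
  shows "\<rho> id (bvec (SYT lam) p) = bvec (SYT lam) p"
  using representation_one_bvec[of "sym_group (sum_list lam)" "SYT lam" \<rho>] assms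
  by (simp add: sym_seminormal_module_def sym_group_one)

section \<open>The action as a tensor product\<close>

text \<open>
  The value at \<open>U\<close> of the vector to which \<open>\<sigma>\<close> should send the basis vector of \<open>T\<close>: identify the
  basis vectors of one alphabet with pure tensors of basis vectors of the symmetric group modules,
  let the induced permutations act on the tensor factors, and place the result in the summand of
  the alphabet moved by \<open>\<sigma>\<close>. It is an induced representation written in coordinates.
\<close>

definition tensor_action ::
    "nat list list \<Rightarrow> (nat \<Rightarrow> (nat \<Rightarrow> nat) \<Rightarrow> (filling \<Rightarrow> complex) \<Rightarrow> filling \<Rightarrow> complex) \<Rightarrow>
     (nat \<Rightarrow> nat) \<Rightarrow> filling list \<Rightarrow> filling list \<Rightarrow> complex" where
  "tensor_action lams \<rho>s \<sigma> T U =
     (if U \<in> rSYT lams \<and> alphabet lams U = map (image \<sigma>) (alphabet lams T)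
      then \<Prod>k<length lams. \<rho>s k (induced \<sigma> (alphabet lams T ! k))
             (bvec (SYT (lams ! k)) (relabel lams T ! k)) (relabel lams U ! k)
      else 0)"

context
  fixes lams :: "nat list list"
    and \<rho>s :: "nat \<Rightarrow> (nat \<Rightarrow> nat) \<Rightarrow> (filling \<Rightarrow> complex) \<Rightarrow> filling \<Rightarrow> complex"
  assumes modules: "\<And>k. k < length lams \<Longrightarrow> sym_seminormal_module (lams ! k) (\<rho>s k)"
begin

lemma tensor_action_id:
  assumes "T \<in> rSYT lams"
  shows "tensor_action lams \<rho>s id T = bvec (rSYT lams) T"
proof
  fix U
  show "tensor_action lams \<rho>s id T U = bvec (rSYT lams) T U"
  proof (cases "U \<in> rSYT lams \<and> alphabet lams U = alphabet lams T")
    case True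
    then have U: "U \<in> rSYT lams" and alph: "alphabet lams U = alphabet lams T" by auto
    have "\<rho>s k (induced id (alphabet lams T ! k)) (bvec (SYT (lams ! k)) (relabel lams T ! k))
        (relabel lams U ! k) = (if relabel lams U ! k = relabel lams T ! k then 1 else 0)"
      if k: "k < length lams" for k
    proof -
      have "induced id (alphabet lams T ! k) = id" "relabel lams T ! k \<in> SYT (lams ! k)"
        using k rSYT_D[OF assms] by (simp_all add: induced_id)
      then show ?thesis
        by (simp only: sym_representation_id[OF modules[OF k]]) (simp add: bvec_def)
    qed
    then have "tensor_action lams \<rho>s id T U =
        (\<Prod>k<length lams. if relabel lams U ! k = relabel lams T ! k then 1 else 0)"
      using True by (simp add: tensor_action_def)
    also have "\<dots> = (if relabel lams U = relabel lams T then 1 else 0)"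
    proof (cases "relabel lams U = relabel lams T")
      case False
      then obtain k where "k < length lams" "relabel lams U ! k \<noteq> relabel lams T ! k"
        using rSYT_D(1)[OF U] rSYT_D(1)[OF assms] by (auto simp: list_eq_iff_nth_eq)
      then show ?thesis using False by (auto intro!: prod_zero)
    qed simp
    finally show ?thesis
      using alphabet_relabel_inj[OF U assms alph] assms by (auto simp: bvec_def)
  next
    case False
    then show ?thesis using assms by (auto simp: tensor_action_def bvec_def)
  qed
qed

text \<open>
  If a permutation of the entries destroys standardness, it does so in some relabeled component, and
  the corresponding tensor factor vanishes. This matches the convention that basis vectors of
  nonstandard tableaux are zero.
\<close>

lemma tensor_action_outside:
  assumes "T \<in> rSYT lams" "\<tau> permutes {1..rsize lams}" "\<sigma> permutes {1..rsize lams}"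
    and "ract lams \<tau> T \<notin> rSYT lams"
  shows "tensor_action lams \<rho>s \<sigma> (ract lams \<tau> T) = (\<lambda>U. 0)"
proof -
  let ?T' = "ract lams \<tau> T"
  note T = rSYT_D[OF assms(1)]
  obtain k where k: "k < length lams" "relabel lams ?T' ! k \<notin> SYT (lams ! k)"
    using assms(4) ract_rSYT_iff[OF assms(1,2)] relabel_ract_nth[OF T(1)] by metis
  let ?E = "alphabet lams ?T' ! k"
  have "alphabet lams ?T' \<in> alphabets lams"
    using alphabets_image[OF T(7) assms(2)] T(1) by (simp add: alphabet_ract)
  then have "card ?E = sum_list (lams ! k)"
    using k by (simp add: alphabets_iff)
  moreover have "finite ?E" using T(1) k by simp
  ultimately have "induced \<sigma> ?E permutes {1..sum_list (lams ! k)}"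
    using induced_permutes permutes_inj[OF assms(3)] by metis
  from sym_representation_outside[OF modules[OF k(1)] k(2) this] k(1) show ?thesis
    by (auto simp: tensor_action_def fun_eq_iff intro!: prod_zero)
qed

text \<open>
  If \<open>i\<close> and \<open>Suc i\<close> do not share a component, exchanging them may change the alphabet but none of
  the relabeled components.
\<close>

lemma tensor_action_adj_different:
  assumes "T \<in> rSYT lams" "\<forall>k<length lams. \<not> (i \<in> alphabet lams T ! k \<and> Suc i \<in> alphabet lams T ! k)"
  shows "tensor_action lams \<rho>s (\<sigma> \<circ> adj i) T = tensor_action lams \<rho>s \<sigma> (ract lams (adj i) T)"
proof -
  note T = rSYT_D[OF assms(1)]
  let ?T' = "ract lams (adj i) T"
  have ind: "induced (\<sigma> \<circ> adj i) (alphabet lams T ! k) = induced \<sigma> (alphabet lams ?T' ! k)"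
    if "k < length lams" for k
    using that assms(2) T(1) by (simp add: induced_comp inj_adj induced_adj_different entries_act)
  have rel: "relabel lams ?T' ! k = relabel lams T ! k" if "k < length lams" for k
    unfolding relabel_ract_nth[OF T(1) that]
    using that assms(2) T(1) by (simp add: induced_adj_different act_id standardize_rank_in)
  have "map (image (\<sigma> \<circ> adj i)) (alphabet lams T) = map (image \<sigma>) (alphabet lams ?T')"
    using T(1) by (simp add: alphabet_ract image_comp)
  then show ?thesis
    unfolding tensor_action_def fun_eq_iff using ind rel by (auto intro!: prod.cong)
qed

text \<open>
  If \<open>i\<close> and \<open>Suc i\<close> lie in the same component \<open>m\<close>, the alphabet stays, and the simple reflection
  becomes a simple reflection acting on the tensor factor \<open>m\<close> alone; its seminormal formula has
  the same coefficient there, and a product is linear in each of its factors.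
\<close>

lemma tensor_action_adj_same:
  assumes "T \<in> rSYT lams" "\<sigma> permutes {1..rsize lams}"
    and m: "m < length lams" "i \<in> alphabet lams T ! m" "Suc i \<in> alphabet lams T ! m"
  defines "a \<equiv> a_coeff (lams ! m) (T ! m) i"
  shows "tensor_action lams \<rho>s (\<sigma> \<circ> adj i) T U =
    a * tensor_action lams \<rho>s \<sigma> T U + (1 + a) * tensor_action lams \<rho>s \<sigma> (ract lams (adj i) T) U"
proof -
  note T = rSYT_D[OF assms(1)]
  let ?T' = "ract lams (adj i) T" and ?E = "\<lambda>k. alphabet lams T ! k"
  have fin: "finite (?E k)" if "k < length lams" for k using that T(1) by simp
  have other: "\<not> (i \<in> ?E k \<and> Suc i \<in> ?E k)" "adj i ` ?E k = ?E k" if "k < length lams" "k \<noteq> m" for k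
  proof -
    have "?E k \<inter> ?E m = {}"
      using T(7) that m(1) by (simp add: alphabets_iff)
    then have *: "i \<notin> ?E k" "Suc i \<notin> ?E k" using m(2,3) by auto
    then show "\<not> (i \<in> ?E k \<and> Suc i \<in> ?E k)" by simp
    show "adj i ` ?E k = ?E k" using * by (simp add: adj_def)
  qed
  have img: "adj i ` ?E k = ?E k" if "k < length lams" for k
    using other(2)[OF that] induced_adj_same(2)[OF fin[OF m(1)] m(2,3)] by (cases "k = m") auto
  have alph: "alphabet lams ?T' = alphabet lams T"
    using img T(1) by (intro nth_equalityI) (auto simp: alphabet_ract)
  have alph_comp: "map (image (\<sigma> \<circ> adj i)) (alphabet lams T) = map (image \<sigma>) (alphabet lams T)"
  proof (rule nth_equalityI)
    fix k assume "k < length (map (image (\<sigma> \<circ> adj i)) (alphabet lams T))"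
    then show "map (image (\<sigma> \<circ> adj i)) (alphabet lams T) ! k = map (image \<sigma>) (alphabet lams T) ! k"
      using img[of k] T(1) by (simp only: nth_map length_map component_length image_comp[symmetric])
  qed simp
  have ind: "induced (\<sigma> \<circ> adj i) (?E k) = induced \<sigma> (?E k) \<circ> induced (adj i) (?E k)"
    if "k < length lams" for k
    using induced_comp[OF fin[OF that] inj_adj] img[OF that] by simp
  define j where "j = rank_in (?E m) i"
  have card_m: "card (?E m) = sum_list (lams ! m)" using T(1) T(5)[OF m(1)] m(1) by simp
  have j: "1 \<le> j" "j < sum_list (lams ! m)"
    using rank_in_range[OF fin[OF m(1)] m(2)] rank_in_range[OF fin[OF m(1)] m(3)] card_m
    by (auto simp: j_def rank_in_Suc[OF fin[OF m(1)] m(3)])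
  \<comment> \<open>The factors at \<open>U\<close> for \<open>\<sigma>\<close> on \<open>T\<close>, for \<open>\<sigma>\<close> on its neighbour, and for \<open>\<sigma> \<circ> adj i\<close> on \<open>T\<close>.\<close>
  define F where "F k = \<rho>s k (induced \<sigma> (?E k)) (bvec (SYT (lams ! k)) (relabel lams T ! k))
      (relabel lams U ! k)" for k
  define F' where "F' k = \<rho>s k (induced \<sigma> (?E k)) (bvec (SYT (lams ! k)) (relabel lams ?T' ! k))
      (relabel lams U ! k)" for k
  define G where "G k = \<rho>s k (induced (\<sigma> \<circ> adj i) (?E k)) (bvec (SYT (lams ! k)) (relabel lams T ! k))
      (relabel lams U ! k)" for k
  have F': "F' k = F k" and G: "G k = F k" if "k < length lams" "k \<noteq> m" for k
  proof -
    have id: "induced (adj i) (?E k) = id"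
      using induced_adj_different[OF fin[OF that(1)] other(1)[OF that]] .
    then show "G k = F k" by (simp add: F_def G_def ind[OF that(1)])
    have "relabel lams ?T' ! k = relabel lams T ! k"
      using relabel_ract_nth[OF T(1) that(1), of "adj i"] id that T(1)
      by (simp add: act_id standardize_rank_in)
    then show "F' k = F k" by (simp add: F_def F'_def)
  qed
  have Gm: "G m = a * F m + (1 + a) * F' m"
  proof -
    have "induced \<sigma> (?E m) permutes {1..sum_list (lams ! m)}"
      using induced_permutes[OF fin[OF m(1)] permutes_inj[OF assms(2)]] card_m by simp
    note mult = sym_representation_mult_adj[OF modules[OF m(1)] _ this j]
    have "relabel lams ?T' ! m = act (lams ! m) (adj j) (relabel lams T ! m)"
      using relabel_ract_nth[OF T(1) m(1), of "adj i"] induced_adj_same(1)[OF fin[OF m(1)] m(2,3)]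
        T(1) m(1) by (simp add: j_def)
    moreover have "a_coeff (lams ! m) (relabel lams T ! m) j = a"
      using a_coeff_standardize[OF T(4)[OF m(1)], of i] m T(1) by (simp add: a_def j_def)
    moreover have "relabel lams T ! m \<in> SYT (lams ! m)" using T m(1) by simp
    ultimately show ?thesis
      using mult[of "relabel lams T ! m"] induced_adj_same(1)[OF fin[OF m(1)] m(2,3)]
      by (simp add: F_def F'_def G_def ind[OF m(1)] j_def)
  qed
  have split: "(\<Prod>k<length lams. H k) = H m * (\<Prod>k\<in>{..<length lams} - {m}. H k)"
    for H :: "nat \<Rightarrow> complex"
    using m(1) by (intro prod.remove) auto
  have "(\<Prod>k\<in>{..<length lams} - {m}. F' k) = (\<Prod>k\<in>{..<length lams} - {m}. F k)"
    "(\<Prod>k\<in>{..<length lams} - {m}. G k) = (\<Prod>k\<in>{..<length lams} - {m}. F k)"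
    using F' G by (auto intro!: prod.cong)
  then have "(\<Prod>k<length lams. G k) = a * (\<Prod>k<length lams. F k) + (1 + a) * (\<Prod>k<length lams. F' k)"
    unfolding split[of F] split[of F'] split[of G] Gm by (simp add: algebra_simps)
  then show ?thesis
    unfolding tensor_action_def alph alph_comp F_def F'_def G_def by simp
qed

text \<open>
  The two sides agree for the identity and transform in the same way when \<open>\<sigma>\<close> is multiplied on the
  right by a simple reflection. The induction hypothesis is needed for all tableaux at once, because
  this reflection replaces \<open>T\<close> by another tableau.
\<close>

lemma wreath_action_eq_tensor_action:
  assumes "lams \<noteq> []" and W: "wreath_seminormal_module (rsize lams) \<xi> lams \<rho>"
    and "\<sigma> permutes {1..rsize lams}" "T \<in> rSYT lams"
  shows "\<rho> (emb (rsize lams) \<sigma>) (bvec (rSYT lams) T) = tensor_action lams \<rho>s \<sigma> T"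
  using assms(3,4)
proof (induction \<sigma> arbitrary: T rule: permutes_adj_induct)
  case id
  have rep: "representation (wreath (length lams) (rsize lams)) (rSYT lams) \<rho>"
    using W by (simp add: wreath_seminormal_module_def Let_def)
  show ?case
    unfolding tensor_action_id[OF id]
    using representation_one_bvec[OF rep, of T] by (simp only: emb_def wreath_simps)
next
  case (adj \<sigma> i)
  let ?r = "length lams" and ?n = "rsize lams" and ?X = "rSYT lams"
  let ?T' = "ract lams (adj i) T"
  have rep: "representation (wreath ?r ?n) ?X \<rho>"
    using W by (simp add: wreath_seminormal_module_def Let_def)
  note T = rSYT_D[OF adj.prems]
  have adj_p: "adj i permutes {1..?n}"
    using adj.hyps by (auto simp: adj_def intro!: permutes_swap_id)
  have carrier: "emb ?n \<pi> \<in> carrier (wreath ?r ?n)" if "\<pi> permutes {1..?n}" for \<pi>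
    using that assms(1) by (auto simp: emb_def wreath_simps)
  have mult: "emb ?n (\<sigma> \<circ> adj i) = emb ?n \<sigma> \<otimes>\<^bsub>wreath ?r ?n\<^esub> emb ?n (adj i)"
    using emb_mult[OF adj.hyps(1)] by simp
  have gen: "gen ?r ?n i = emb ?n (adj i)" using adj.hyps by (simp add: gen_def)
  \<comment> \<open>The induction hypothesis extends to the neighbour of \<open>T\<close>: if that is nonstandard, both sides vanish.\<close>
  have IH': "\<rho> (emb ?n \<sigma>) (bvec ?X ?T') = tensor_action lams \<rho>s \<sigma> ?T'"
  proof (cases "?T' \<in> ?X")
    case False
    then show ?thesis
      using representation_bvec_outside[OF rep carrier[OF adj.hyps(1)] False]
        tensor_action_outside[OF adj.prems adj_p adj.hyps(1) False] by simp
  qed (rule adj.IH)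
  have "i \<in> (\<Union>k<?r. alphabet lams T ! k)" "Suc i \<in> (\<Union>k<?r. alphabet lams T ! k)"
    using T(7) adj.hyps by (simp_all add: alphabets_iff)
  then obtain k l where kl: "k < ?r" "i \<in> alphabet lams T ! k" "l < ?r" "Suc i \<in> alphabet lams T ! l"
    by blast
  then have kl': "i \<in> entries (lams ! k) (T ! k)" "Suc i \<in> entries (lams ! l) (T ! l)"
    using T(1) by simp_all
  have step: "\<rho> (emb ?n (adj i)) (bvec ?X T) =
     (if k \<noteq> l then bvec ?X ?T'
      else (\<lambda>U. a_coeff (lams ! k) (T ! k) i * bvec ?X T U +
                (1 + a_coeff (lams ! k) (T ! k) i) * bvec ?X ?T' U))"
    using W adj.prems adj.hyps kl(1,3) kl' unfolding wreath_seminormal_module_def Let_def gen[symmetric]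
    by blast
  show ?case
  proof (cases "k = l")
    case True
    let ?a = "a_coeff (lams ! k) (T ! k) i"
    have "\<rho> (emb ?n (\<sigma> \<circ> adj i)) (bvec ?X T) =
        (\<lambda>U. ?a * \<rho> (emb ?n \<sigma>) (bvec ?X T) U + (1 + ?a) * \<rho> (emb ?n \<sigma>) (bvec ?X ?T') U)"
      unfolding mult
      using representation_mult_bvec[OF rep carrier[OF adj.hyps(1)] carrier[OF adj_p]] step True
      by simp
    also have "\<dots> = tensor_action lams \<rho>s (\<sigma> \<circ> adj i) T"
      unfolding adj.IH[OF adj.prems] IH'
      by (intro ext tensor_action_adj_same[OF adj.prems adj.hyps(1) kl(1,2) kl(4)[folded True], symmetric])
    finally show ?thesis .
  next
    case False
    have moved: "\<rho> (emb ?n (\<sigma> \<circ> adj i)) (bvec ?X T) = \<rho> (emb ?n \<sigma>) (bvec ?X ?T')"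
      using representation_mult_bvec[OF rep carrier[OF adj.hyps(1)] carrier[OF adj_p], of T 0 1 ?T']
        step False by (simp add: mult)
    have apart: "\<not> (i \<in> alphabet lams T ! k' \<and> Suc i \<in> alphabet lams T ! k')" if "k' < ?r" for k'
    proof
      assume *: "i \<in> alphabet lams T ! k' \<and> Suc i \<in> alphabet lams T ! k'"
      have "p = q" if "p < ?r" "q < ?r" "x \<in> alphabet lams T ! p" "x \<in> alphabet lams T ! q" for p q x
        using T(7) that unfolding alphabets_iff disjoint_iff by metis
      then show False using * kl that False by metis
    qed
    show ?thesis
      unfolding moved IH'
      by (rule tensor_action_adj_different[OF adj.prems, symmetric]) (use apart in blast)
  qed
qed

end

section \<open>The transition matrix\<close>

lemma finite_SYT: "finite (SYT lam)"
proof (rule finite_subset)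
  show "SYT lam \<subseteq> diagram lam \<rightarrow>\<^sub>E {1..sum_list lam}"
    by (auto simp: SYT_def PiE_def bij_betw_def)
qed (simp add: finite_PiE)

lemma finite_rSYT: "finite (rSYT lams)"
proof -
  have "finite (listset (map SYT lams))"
  proof (rule finite_subset)
    show "listset (map SYT lams) \<subseteq> {P. set P \<subseteq> (\<Union>lam\<in>set lams. SYT lam) \<and> length P = length lams}"
      by (auto simp: in_listset_iff in_set_conv_nth) (metis nth_mem)
  qed (intro finite_lists_length_eq finite_UN_I finite_SYT, simp)
  then show ?thesis
    using bij_betw_finite[OF bij_betw_alphabet_relabel[of lams]] finite_alphabets by simp
qed

theorem corollary6p15:
  fixes r n :: nat
    and \<xi> :: complex
    and lams :: "nat list list"
    and \<rho> :: "(nat \<Rightarrow> nat) \<times> (nat \<Rightarrow> nat) \<Rightarrow> (filling list \<Rightarrow> complex) \<Rightarrow> filling list \<Rightarrow> complex"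
    and A :: "filling list \<Rightarrow> filling list \<Rightarrow> complex"
    and \<rho>s :: "nat \<Rightarrow> (nat \<Rightarrow> nat) \<Rightarrow> (filling \<Rightarrow> complex) \<Rightarrow> filling \<Rightarrow> complex"
    and As :: "nat \<Rightarrow> filling \<Rightarrow> filling \<Rightarrow> complex"
  assumes "r_partition r n lams"
    and "primitive_root_of_unity r \<xi>"
    and "wreath_seminormal_module n \<xi> lams \<rho>"
    and "transition_matrix (rSYT lams) (bvec (rSYT lams)) (wreath_natural n lams \<rho>) A"
    and "\<And>k. k < r \<Longrightarrow> sym_seminormal_module (lams ! k) (\<rho>s k)"
    and "\<And>k. k < r \<Longrightarrow>
           transition_matrix (SYT (lams ! k)) (bvec (SYT (lams ! k)))
             (sym_natural (lams ! k) (\<rho>s k)) (As k)"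
  shows "bij_betw (\<lambda>T. (alphabet lams T, relabel lams T)) (rSYT lams)
           (alphabets lams \<times> listset (map SYT lams))
       \<and> card (alphabets lams) = fact n div (\<Prod>k<r. fact (sum_list (lams ! k)))
       \<and> (\<forall>S\<in>rSYT lams. \<forall>T\<in>rSYT lams.
            A S T = direct_sum_copies (tensor_matrix (map As [0..<r]))
                      (alphabet lams S, relabel lams S) (alphabet lams T, relabel lams T))
       \<and> (\<forall>S\<in>rSYT lams. \<forall>T\<in>rSYT lams. \<forall>S'\<in>rSYT lams. \<forall>T'\<in>rSYT lams.
            alphabet lams S = alphabet lams T \<longrightarrow> alphabet lams S' = alphabet lams T' \<longrightarrow>
            relabel lams S = relabel lams S' \<longrightarrow> relabel lams T = relabel lams T' \<longrightarrow>
            A S T = A S' T')"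
proof -
  have r: "length lams = r" "rsize lams = n" "0 < r" and parts: "\<forall>lam\<in>set lams. is_partition lam"
    using assms(1,2) by (simp_all add: r_partition_def primitive_root_of_unity_def)
  let ?C = "rcolumn_reading lams"
  note C = rcolumn_reading_props[OF parts]
  have entry: "A S T = direct_sum_copies (tensor_matrix (map As [0..<r]))
                (alphabet lams S, relabel lams S) (alphabet lams T, relabel lams T)"
    if S: "S \<in> rSYT lams" and T: "T \<in> rSYT lams" for S T
  proof -
    note w = rw_perm_props[OF parts T]
    have "A S T = \<rho> (emb n (rw_perm lams T)) (bvec (rSYT lams) ?C) S"
      using transition_matrix_entry[OF assms(4) finite_rSYT S T] by (simp add: wreath_natural_def)
    also have "\<dots> = tensor_action lams \<rho>s (rw_perm lams T) ?C S"
      using wreath_action_eq_tensor_action[of lams \<rho>s \<xi> \<rho>, OF assms(5) _ _ w(1) C(1)] r assms(3)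
      by auto
    finally have A: "A S T = tensor_action lams \<rho>s (rw_perm lams T) ?C S" .
    have alph: "map (image (rw_perm lams T)) (alphabet lams ?C) = alphabet lams T"
      using alphabet_ract[of ?C lams "rw_perm lams T"] w(2) by simp
    have factor: "\<rho>s k (induced (rw_perm lams T) (alphabet lams ?C ! k))
          (bvec (SYT (lams ! k)) (relabel lams ?C ! k)) (relabel lams S ! k) =
        As k (relabel lams S ! k) (relabel lams T ! k)" if k: "k < r" for k
    proof -
      have "relabel lams S ! k \<in> SYT (lams ! k)" "relabel lams T ! k \<in> SYT (lams ! k)"
        using rSYT_D[OF S] rSYT_D[OF T] k r by simp_all
      from transition_matrix_entry[OF assms(6)[OF k] finite_SYT this]
      show ?thesis
        using w_perm_relabel[OF parts T] C(2) k r by (simp add: sym_natural_def)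
    qed
    show ?thesis
      unfolding A tensor_action_def alph using factor S r
      by (simp add: direct_sum_copies_def tensor_matrix_def)
  qed
  show ?thesis
  proof (intro conjI ballI impI)
    show "bij_betw (\<lambda>T. (alphabet lams T, relabel lams T)) (rSYT lams)
           (alphabets lams \<times> listset (map SYT lams))"
      by (rule bij_betw_alphabet_relabel)
    show "card (alphabets lams) = fact n div (\<Prod>k<r. fact (sum_list (lams ! k)))"
      using card_alphabets[of lams] r by simp
  next
    fix S T assume "S \<in> rSYT lams" "T \<in> rSYT lams"
    then show "A S T = direct_sum_copies (tensor_matrix (map As [0..<r]))
                (alphabet lams S, relabel lams S) (alphabet lams T, relabel lams T)"
      by (rule entry)
  next
    fix S T S' T'
    assume "S \<in> rSYT lams" "T \<in> rSYT lams" "S' \<in> rSYT lams" "T' \<in> rSYT lams"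
      "alphabet lams S = alphabet lams T" "alphabet lams S' = alphabet lams T'"
      "relabel lams S = relabel lams S'" "relabel lams T = relabel lams T'"
    then show "A S T = A S' T'"
      by (simp add: entry direct_sum_copies_def)
  qed
qed

end
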